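(* Let $G=(V,E)$ be a 4-edge-connected 4-regular graph with an even number of vertices and with no proper 4-edge cut. Then the vector $(\frac32-\frac1{42})\cdot(\frac12\chi^{E})$ dominates (is coordinatewise at least) a convex combination of incidence vectors of tours of $G$.
   Context: A cut $U\subset V$ is proper if $|U|\ge2$ and $|V\setminus U|\ge2$; a proper 4-edge cut is a proper cut $U$ with $|\delta(U)|=4$, where $\delta(U)$ is the set of edges with exactly one endpoint in $U$. $\chi^E$ is the all-ones vector on $E$. A tour of $G$ is a connected, spanning, Eulerian multigraph on $V$ using only edges of $E$ (edges may be repeated); its incidence vector records edge multiplicities. *)

theory Defs
  imports Complex_Main
begin

definition multigraph :: "'v set \<Rightarrow> 'e set \<Rightarrow> ('e \<Rightarrow> 'v set) \<Rightarrow> bool" where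
  "multigraph V E ends \<longleftrightarrow> finite V \<and> finite E \<and>
     (\<forall>e\<in>E. ends e \<subseteq> V \<and> card (ends e) = 2)"

definition cut_edges :: "'e set \<Rightarrow> ('e \<Rightarrow> 'v set) \<Rightarrow> 'v set \<Rightarrow> 'e set" where
  "cut_edges E ends U = {e\<in>E. card (ends e \<inter> U) = 1}"

definition degree :: "'e set \<Rightarrow> ('e \<Rightarrow> 'v set) \<Rightarrow> 'v \<Rightarrow> nat" where
  "degree E ends v = card {e\<in>E. v \<in> ends e}"

definition regular :: "nat \<Rightarrow> 'v set \<Rightarrow> 'e set \<Rightarrow> ('e \<Rightarrow> 'v set) \<Rightarrow> bool" where
  "regular k V E ends \<longleftrightarrow> (\<forall>v\<in>V. degree E ends v = k)"

definition edge_connected :: "nat \<Rightarrow> 'v set \<Rightarrow> 'e set \<Rightarrow> ('e \<Rightarrow> 'v set) \<Rightarrow> bool" where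
  "edge_connected k V E ends \<longleftrightarrow>
     (\<forall>U. U \<subseteq> V \<and> U \<noteq> {} \<and> U \<noteq> V \<longrightarrow> card (cut_edges E ends U) \<ge> k)"

definition proper_cut :: "'v set \<Rightarrow> 'v set \<Rightarrow> bool" where
  "proper_cut V U \<longleftrightarrow> U \<subseteq> V \<and> card U \<ge> 2 \<and> card (V - U) \<ge> 2"

definition has_proper_4_edge_cut :: "'v set \<Rightarrow> 'e set \<Rightarrow> ('e \<Rightarrow> 'v set) \<Rightarrow> bool" where
  "has_proper_4_edge_cut V E ends \<longleftrightarrow>
     (\<exists>U. proper_cut V U \<and> card (cut_edges E ends U) = 4)"

text \<open>Tours, given by edge multiplicity vectors x (zero outside E).
  The multigraph is connected and spanning: any two vertices of V are joined by a walk
  along edges of positive multiplicity; it is Eulerian: every vertex has even degree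
  (counted with multiplicity).\<close>
definition adj_in :: "'e set \<Rightarrow> ('e \<Rightarrow> 'v set) \<Rightarrow> ('e \<Rightarrow> nat) \<Rightarrow> 'v \<Rightarrow> 'v \<Rightarrow> bool" where
  "adj_in E ends x u v \<longleftrightarrow> (\<exists>e\<in>E. x e > 0 \<and> ends e = {u, v})"

definition is_tour :: "'v set \<Rightarrow> 'e set \<Rightarrow> ('e \<Rightarrow> 'v set) \<Rightarrow> ('e \<Rightarrow> nat) \<Rightarrow> bool" where
  "is_tour V E ends x \<longleftrightarrow>
     (\<forall>e. e \<notin> E \<longrightarrow> x e = 0) \<and>
     (\<forall>u\<in>V. \<forall>v\<in>V. (adj_in E ends x)\<^sup>*\<^sup>* u v) \<and>
     (\<forall>v\<in>V. even (\<Sum>e\<in>{e\<in>E. v \<in> ends e}. x e))"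

definition dominates_convex_tours ::
  "'v set \<Rightarrow> 'e set \<Rightarrow> ('e \<Rightarrow> 'v set) \<Rightarrow> ('e \<Rightarrow> real) \<Rightarrow> bool" where
  "dominates_convex_tours V E ends y \<longleftrightarrow>
     (\<exists>T lam. finite T \<and> (\<forall>x\<in>T. is_tour V E ends x) \<and>
        (\<forall>x\<in>T. lam x \<ge> (0::real)) \<and> sum lam T = 1 \<and>
        (\<forall>e\<in>E. (\<Sum>x\<in>T. lam x * real (x e)) \<le> y e))"

end

theory Submission
  imports Defs
begin

text \<open>The vector \<open>1/4\<close> lies in the perfect matching polytope, being a point of the \<open>V\<close>-join
  polyhedron with degree one at every vertex. For a perfect matching \<open>M\<close>, colour its edges with seven
  colours such that two edges of the same colour are not adjacent to a common edge outside \<open>M\<close>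
  (each edge has at most six conflicts), and let \<open>N\<close> be a colour class. All proper cuts have at least
  six edges, so the vector equal to \<open>1\<close> on \<open>M\<close> and \<open>1/3\<close> elsewhere satisfies the cut conditions for
  connected spanning subgraphs; as the stars of the end vertices of \<open>N\<close> outside \<open>M\<close> are disjoint,
  integrality of the intersection with a partition matroid makes it dominate a convex combination of
  connected subgraphs containing \<open>M\<close> that have degree two at every end of \<open>N\<close>. The parity of such a
  subgraph \<open>T\<close> is corrected by joins that \<open>1/6 + (M - N)/3\<close> dominates: only trivial cuts could violate
  the cut conditions, and the stars of odd vertices of \<open>T\<close> meet \<open>M - N\<close>. The sum
  \<open>1/2 + M - N/3\<close> averages to \<open>1/2 + 20/21 M\<close> over the colours, and then to \<open>1/2 + 5/21 = 31/42\<close>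
  over the matchings.\<close>

subsection \<open>Convex combinations\<close>

text \<open>If every vertex may need parity correction, a star with one matching edge requires
  \<open>4/6 + 1/3 = 1\<close>, nothing can be saved, and the average is
  \<open>1/2 + 1/4 = 3/4\<close>, which is the factor 3/2. Saving 1/3 on an edge of \<open>N\<close>
  is safe only if both its ends have even degree in the connected subgraph. That is why these
  degrees are prescribed, and the stars must be disjoint for the prescribed degrees to form a
  partition matroid. An edge lies in the matching with weight 1/4 and then in \<open>N\<close> with
  weight 1/7, so the gain is \<open>1/3 * 1/7 * 1/4 = 1/84\<close>, half of 1/42.

  Integrality is needed for connected subgraphs and for joins. In both cases a point that is not yet
  handled is moved both ways along a direction that keeps its tight constraints; counting these
  constraints against the fractional coordinates yields the direction. For joins, tight cuts with at
  least two vertices on each side are treated before that, by contracting either side and gluing the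
  two combinations. Domination suffices throughout, since tight constraints restore equality where
  it matters.\<close>

text \<open>\<open>dominates E \<phi> X y\<close>: on \<open>E\<close>, the vector \<open>y\<close> is at least some convex combination of the vectors
  \<open>\<phi> x\<close> with \<open>x \<in> X\<close>.\<close>

inductive dominates :: "'e set \<Rightarrow> ('x \<Rightarrow> 'e \<Rightarrow> real) \<Rightarrow> 'x set \<Rightarrow> ('e \<Rightarrow> real) \<Rightarrow> bool"
  for E \<phi> X where
  base: "x \<in> X \<Longrightarrow> \<forall>e\<in>E. \<phi> x e \<le> y e \<Longrightarrow> dominates E \<phi> X y"
| mix: "dominates E \<phi> X y1 \<Longrightarrow> dominates E \<phi> X y2 \<Longrightarrow> 0 < t \<Longrightarrow> t < 1 \<Longrightarrow>
    \<forall>e\<in>E. t * y1 e + (1 - t) * y2 e \<le> y e \<Longrightarrow> dominates E \<phi> X y"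

lemma dominates_weaken:
  assumes "dominates E \<phi> X y" and "\<forall>e\<in>E. y e \<le> y' e"
  shows "dominates E \<phi> X y'"
  using assms(1)
proof (cases rule: dominates.cases)
  case (base x)
  have "\<forall>e\<in>E. \<phi> x e \<le> y' e" using base(2) assms(2) by fastforce
  then show ?thesis by (rule dominates.base[OF base(1)])
next
  case (mix y1 y2 t)
  have "\<forall>e\<in>E. t * y1 e + (1 - t) * y2 e \<le> y' e" using mix(5) assms(2) by fastforce
  then show ?thesis by (rule dominates.mix[OF mix(1-4)])
qed

text \<open>The rule \<open>mix\<close> has strictly positive weights, so that inductions can pass
  tightness and vanishing on to both halves; the two degenerate weights are recovered here by
  monotonicity.\<close>

lemma dominates_convex:
  assumes "dominates E \<phi> X y1" and "dominates E \<phi> X y2" and "0 \<le> t" and "t \<le> 1"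
    and "\<forall>e\<in>E. t * y1 e + (1 - t) * y2 e \<le> y e"
  shows "dominates E \<phi> X y"
proof -
  consider "t = 0" | "t = 1" | "0 < t" "t < 1" using assms(3,4) by linarith
  then show ?thesis
  proof cases
    case 1 then show ?thesis using assms(2,5) by (auto intro: dominates_weaken)
  next
    case 2 then show ?thesis using assms(1,5) by (auto intro: dominates_weaken)
  next
    case 3 then show ?thesis using dominates.mix[OF assms(1,2) _ _ assms(5)] by blast
  qed
qed

text \<open>Affine maps with nonnegative slopes commute with convex combinations, so each
  \<open>x\<close> may be replaced by its own combination from \<open>Y\<close>. The offset carries
  what is already fixed, such as a contracted edge or a connected subgraph that awaits its
  join.\<close>

lemma dominates_trans:
  assumes "dominates E \<phi> X y" and "\<forall>x\<in>X. dominates E \<psi> Y (\<lambda>e. a e + c e * \<phi> x e)"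
    and "\<forall>e\<in>E. c e \<ge> 0" and "\<forall>e\<in>E. a e + c e * y e \<le> y' e"
  shows "dominates E \<psi> Y y'"
  using assms(1,4)
proof (induction arbitrary: y' rule: dominates.induct)
  case (base x y)
  have "\<forall>e\<in>E. a e + c e * \<phi> x e \<le> y' e"
    using base assms(3) by (meson add_left_mono mult_left_mono order_trans)
  then show ?case by (rule dominates_weaken[OF bspec[OF assms(2) base(1)]])
next
  case (mix y1 y2 t y)
  have 1: "dominates E \<psi> Y (\<lambda>e. a e + c e * y1 e)" using mix by simp
  have 2: "dominates E \<psi> Y (\<lambda>e. a e + c e * y2 e)" using mix by simp
  have "\<forall>e\<in>E. t * (a e + c e * y1 e) + (1 - t) * (a e + c e * y2 e) \<le> y' e"
  proof
    fix e assume e: "e \<in> E"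
    have "t * (a e + c e * y1 e) + (1 - t) * (a e + c e * y2 e)
        = a e + c e * (t * y1 e + (1 - t) * y2 e)" by algebra
    also have "\<dots> \<le> a e + c e * y e" using mix e assms(3) by (simp add: mult_left_mono)
    also have "\<dots> \<le> y' e" using mix e by blast
    finally show "t * (a e + c e * y1 e) + (1 - t) * (a e + c e * y2 e) \<le> y' e" .
  qed
  then show ?case by (rule dominates.mix[OF 1 2 mix(3,4)])
qed

lemma dominates_mono:
  assumes "dominates E \<phi> X y" and "X \<subseteq> Y"
  shows "dominates E \<phi> Y y"
proof (rule dominates_trans[OF assms(1), where a = "\<lambda>_. 0" and c = "\<lambda>_. 1"])
  show "\<forall>x\<in>X. dominates E \<phi> Y (\<lambda>e. 0 + 1 * \<phi> x e)"
  proof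
    fix x assume "x \<in> X"
    then have "x \<in> Y" using assms(2) by blast
    then show "dominates E \<phi> Y (\<lambda>e. 0 + 1 * \<phi> x e)" by (rule dominates.base) simp
  qed
qed simp_all

lemma dominates_combination:
  assumes "dominates E \<phi> X y"
  shows "\<exists>T lam. finite T \<and> T \<subseteq> X \<and> (\<forall>x\<in>T. lam x \<ge> 0) \<and> sum lam T = (1::real) \<and>
    (\<forall>e\<in>E. (\<Sum>x\<in>T. lam x * \<phi> x e) \<le> y e)"
  using assms
proof (induction rule: dominates.induct)
  case (base x y)
  then show ?case by (intro exI[of _ "{x}"] exI[of _ "\<lambda>_. 1"]) auto
next
  case (mix y1 y2 t y)
  from mix(6) obtain T1 l1 where T1: "finite T1" "T1 \<subseteq> X" "\<forall>x\<in>T1. l1 x \<ge> 0" "sum l1 T1 = 1"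
    "\<forall>e\<in>E. (\<Sum>x\<in>T1. l1 x * \<phi> x e) \<le> y1 e" by (elim exE conjE)
  from mix(7) obtain T2 l2 where T2: "finite T2" "T2 \<subseteq> X" "\<forall>x\<in>T2. l2 x \<ge> 0" "sum l2 T2 = 1"
    "\<forall>e\<in>E. (\<Sum>x\<in>T2. l2 x * \<phi> x e) \<le> y2 e" by (elim exE conjE)
  \<comment> \<open>The two supports may overlap, so both weights are extended by zero and added on
    the union.\<close>
  define l where "l x = t * (if x \<in> T1 then l1 x else 0) + (1 - t) * (if x \<in> T2 then l2 x else 0)" for x
  have fin: "finite (T1 \<union> T2)" using T1 T2 by simp
  have s: "(\<Sum>x\<in>T1 \<union> T2. l x * g x)
      = t * (\<Sum>x\<in>T1. l1 x * g x) + (1 - t) * (\<Sum>x\<in>T2. l2 x * g x)" for g :: "'b \<Rightarrow> real"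
  proof -
    have "(\<Sum>x\<in>T1 \<union> T2. l x * g x) = t * (\<Sum>x\<in>T1 \<union> T2. if x \<in> T1 then l1 x * g x else 0)
      + (1 - t) * (\<Sum>x\<in>T1 \<union> T2. if x \<in> T2 then l2 x * g x else 0)"
      unfolding l_def sum_distrib_left sum.distrib[symmetric]
      by (intro sum.cong refl) (simp add: algebra_simps)
    also have "(\<Sum>x\<in>T1 \<union> T2. if x \<in> T1 then l1 x * g x else 0) = (\<Sum>x\<in>T1. l1 x * g x)"
      using fin by (subst sum.inter_restrict[symmetric]) (simp_all add: Int_absorb1)
    also have "(\<Sum>x\<in>T1 \<union> T2. if x \<in> T2 then l2 x * g x else 0) = (\<Sum>x\<in>T2. l2 x * g x)"
      using fin by (subst sum.inter_restrict[symmetric]) (simp_all add: Int_absorb1)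
    finally show ?thesis .
  qed
  have "\<forall>x\<in>T1 \<union> T2. l x \<ge> 0" unfolding l_def using T1(3) T2(3) mix(3,4) by auto
  moreover have "sum l (T1 \<union> T2) = 1" using s[of "\<lambda>_. 1"] T1(4) T2(4) by simp
  moreover have "(\<Sum>x\<in>T1 \<union> T2. l x * \<phi> x e) \<le> y e" if "e \<in> E" for e
  proof -
    have "t * (\<Sum>x\<in>T1. l1 x * \<phi> x e) + (1 - t) * (\<Sum>x\<in>T2. l2 x * \<phi> x e) \<le> t * y1 e + (1 - t) * y2 e"
      using T1(5) T2(5) mix(3,4) that by (intro add_mono mult_left_mono) auto
    then show ?thesis using s[of "\<lambda>x. \<phi> x e"] mix(5) that by fastforce
  qed
  ultimately show ?case using fin T1(2) T2(2)
    by (intro exI[of _ "T1 \<union> T2"] exI[of _ l]) blast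
qed

lemma dominates_sum:
  assumes "finite I" and "\<forall>i\<in>I. w i \<ge> (0::real)" and "\<forall>i\<in>I. w i > 0 \<longrightarrow> dominates E \<phi> X (y i)"
    and "sum w I > 0"
  shows "dominates E \<phi> X (\<lambda>e. (\<Sum>i\<in>I. w i * y i e) / sum w I)"
  using assms
proof (induction rule: finite_induct)
  case empty
  then show ?case by simp
next
  case (insert j I)
  have nn: "sum w I \<ge> 0" using insert by (simp add: sum_nonneg)
  consider "sum w I = 0" | "w j = 0" | "sum w I > 0" "w j > 0"
    using nn insert.prems(1) by fastforce
  then show ?case
  proof cases
    case 1
    then have "\<forall>i\<in>I. w i = 0" using insert by (simp add: sum_nonneg_eq_0_iff)
    then have "(\<Sum>i\<in>I. w i * y i e) = 0" for e by simp
    then show ?thesis using 1 insert by simp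
  next
    case 2
    then show ?thesis using insert by simp
  next
    case 3
    have 4: "dominates E \<phi> X (\<lambda>e. (\<Sum>i\<in>I. w i * y i e) / sum w I)" using insert 3 by simp
    have 5: "dominates E \<phi> X (y j)" using insert 3 by simp
    let ?t = "w j / (w j + sum w I)"
    have 6: "1 - ?t = sum w I / (w j + sum w I)" using 3 by (simp add: field_simps)
    show ?thesis
      by (rule dominates_convex[OF 5 4, of ?t]) (use 3 insert in \<open>simp_all add: 6 add_divide_distrib\<close>)
  qed
qed

section \<open>Valid inequalities, faces and supports\<close>

lemma dominates_sum_ge:
  assumes "dominates E \<phi> X y" and "finite D" and "D \<subseteq> E" and "\<forall>x\<in>X. r \<le> (\<Sum>e\<in>D. \<phi> x e)"
  shows "r \<le> sum y D"
  using assms(1)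
proof (induction rule: dominates.induct)
  case (base x y)
  then show ?case using assms(3,4) by (smt (verit, best) subsetD sum_mono)
next
  case (mix y1 y2 t y)
  have "r = t * r + (1 - t) * r" by algebra
  also have "\<dots> \<le> t * sum y1 D + (1 - t) * sum y2 D"
    using mix by (intro add_mono mult_left_mono) auto
  also have "\<dots> = (\<Sum>e\<in>D. t * y1 e + (1 - t) * y2 e)" by (simp add: sum.distrib sum_distrib_left)
  also have "\<dots> \<le> sum y D" using mix(5) assms(3) by (intro sum_mono) auto
  finally show ?case .
qed

text \<open>A point on a face is a combination of points of that face. Although \<open>y\<close> is
  only an upper bound, \<open>sum y D \<le> r\<close> and the validity of the inequality squeeze
  both halves of a mixture to equality.\<close>

lemma dominates_restrict_tight:
  assumes "dominates E \<phi> X y" and "\<forall>D\<in>\<D>. finite D \<and> D \<subseteq> E"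
    and ge: "\<forall>D\<in>\<D>. \<forall>x\<in>X. r \<le> (\<Sum>e\<in>D. \<phi> x e)"
    and "\<forall>D\<in>\<D>. sum y D \<le> r"
  shows "dominates E \<phi> {x\<in>X. \<forall>D\<in>\<D>. (\<Sum>e\<in>D. \<phi> x e) = r} y"
  using assms(1,4)
proof (induction rule: dominates.induct)
  case (base x y)
  have "(\<Sum>e\<in>D. \<phi> x e) = r" if D: "D \<in> \<D>" for D
  proof -
    have "(\<Sum>e\<in>D. \<phi> x e) \<le> sum y D" using base assms(2) D by (intro sum_mono) auto
    then show ?thesis using base D ge by force
  qed
  then have "x \<in> {x \<in> X. \<forall>D\<in>\<D>. (\<Sum>e\<in>D. \<phi> x e) = r}" using base(1) by simp
  then show ?case using base(2) by (rule dominates.base)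
next
  case (mix y1 y2 t y)
  have le: "sum y1 D \<le> r \<and> sum y2 D \<le> r" if D: "D \<in> \<D>" for D
  proof -
    have D': "finite D" "D \<subseteq> E" "\<forall>x\<in>X. r \<le> (\<Sum>e\<in>D. \<phi> x e)" using assms(2) ge D by blast+
    have g1: "r \<le> sum y1 D" by (rule dominates_sum_ge[OF mix(1) D'])
    have g2: "r \<le> sum y2 D" by (rule dominates_sum_ge[OF mix(2) D'])
    have "t * sum y1 D + (1 - t) * sum y2 D = (\<Sum>e\<in>D. t * y1 e + (1 - t) * y2 e)"
      by (simp add: sum.distrib sum_distrib_left)
    also have "\<dots> \<le> sum y D" using mix(5) assms(2) D by (intro sum_mono) auto
    also have "\<dots> \<le> r" using mix D by blast
    finally have l: "t * (sum y1 D - r) + (1 - t) * (sum y2 D - r) \<le> 0" by (simp add: algebra_simps)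
    have "t * (sum y1 D - r) \<ge> 0" "(1 - t) * (sum y2 D - r) \<ge> 0" using g1 g2 mix(3,4) by auto
    then have "t * (sum y1 D - r) \<le> 0" "(1 - t) * (sum y2 D - r) \<le> 0" using l by linarith+
    then show ?thesis using mix(3,4) by (auto simp: mult_le_0_iff)
  qed
  show ?case by (rule dominates.mix[OF mix(6,7) mix(3,4,5)]) (use le in simp_all)
qed

lemma dominates_support:
  assumes "dominates E \<phi> X y" and "\<forall>x\<in>X. \<forall>e\<in>E. 0 \<le> \<phi> x e"
  shows "\<exists>x\<in>X. \<forall>e\<in>E. y e \<le> 0 \<longrightarrow> \<phi> x e = 0"
proof -
  \<comment> \<open>Nonnegativity of \<open>y\<close> is carried along in the induction: a mixture
    that is at most 0 forces \<open>y1 e \<le> 0\<close> only because \<open>y2 e\<close> cannot be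
    negative.\<close>
  have *: "\<exists>x\<in>X. \<forall>e\<in>E. y e \<le> 0 \<longrightarrow> \<phi> x e = 0" "\<forall>e\<in>E. 0 \<le> y e" using assms(1)
  proof (induction rule: dominates.induct)
    case (base x y)
    { case 1 then show ?case using base assms(2) by (meson order_antisym order_trans) }
    { case 2 then show ?case using base assms(2) by (auto intro: order_trans) }
  next
    case (mix y1 y2 t y)
    { case 1
      have "y1 e \<le> 0" if "e \<in> E" "y e \<le> 0" for e
      proof -
        have "t * y1 e + (1 - t) * y2 e \<le> 0" using mix that by force
        moreover have "(1 - t) * y2 e \<ge> 0" using mix that by simp
        ultimately have "t * y1 e \<le> 0" by linarith
        then show ?thesis using mix(3) by (simp add: mult_le_0_iff)
      qed
      then show ?case using mix by blast }
    { case 2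
      have "0 \<le> t * y1 e + (1 - t) * y2 e" if "e \<in> E" for e
        using mix that by (intro add_nonneg_nonneg mult_nonneg_nonneg) auto
      then show ?case using mix(5) by fastforce }
  qed
  show ?thesis by (rule *)
qed

text \<open>Gaussian elimination: each equation costs at most one unknown, so a nontrivial solution
  remains.\<close>

lemma homogeneous_solution:
  fixes a :: "'i \<Rightarrow> 'e \<Rightarrow> real"
  assumes "finite A" and "finite F" and "card A < card F"
  shows "\<exists>d. (\<exists>e\<in>F. d e \<noteq> 0) \<and> (\<forall>e. e \<notin> F \<longrightarrow> d e = 0) \<and> (\<forall>i\<in>A. (\<Sum>e\<in>F. a i e * d e) = 0)"
  using assms
proof (induction A arbitrary: F a rule: finite_induct)
  case empty
  then obtain e where "e \<in> F" by fastforce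
  then show ?case by (intro exI[of _ "\<lambda>f. if f = e then 1 else 0"]) auto
next
  case (insert j A)
  show ?case
  proof (cases "\<forall>e\<in>F. a j e = 0")
    case True
    have "card A < card F" using insert by simp
    then obtain d where "\<exists>e\<in>F. d e \<noteq> 0" "\<forall>e. e \<notin> F \<longrightarrow> d e = 0"
      "\<forall>i\<in>A. (\<Sum>e\<in>F. a i e * d e) = 0" using insert.IH[OF insert.prems(1), of a] by blast
    then show ?thesis using True by (intro exI[of _ d]) auto
  next
    case False
    then obtain g where g: "g \<in> F" "a j g \<noteq> 0" by blast
    \<comment> \<open>\<open>g\<close> is the pivot. Row \<open>j\<close> determines its value
      \<open>s\<close> from the other unknowns, and substituting that value changes the coefficients
      of the remaining rows.\<close>
    let ?F = "F - {g}"
    have "finite ?F" and "card A < card ?F" using insert g by simp_all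
    then obtain d where d: "\<exists>e\<in>?F. d e \<noteq> 0" "\<forall>e. e \<notin> ?F \<longrightarrow> d e = 0"
      "\<forall>i\<in>A. (\<Sum>e\<in>?F. (a i e - a i g * a j e / a j g) * d e) = 0"
      using insert.IH[OF \<open>finite ?F\<close> \<open>card A < card ?F\<close>, of "\<lambda>i e. a i e - a i g * a j e / a j g"]
      by (elim exE conjE)
    define s where "s = - (\<Sum>e\<in>?F. a j e * d e) / a j g"
    let ?d = "d(g := s)"
    have e: "(\<Sum>e\<in>F. a i e * ?d e) = a i g * s + (\<Sum>e\<in>?F. a i e * d e)" for i
    proof -
      have "(\<Sum>e\<in>F. a i e * ?d e) = a i g * s + (\<Sum>e\<in>?F. a i e * ?d e)"
        using g insert.prems by (subst sum.remove[of F g]) auto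
      also have "(\<Sum>e\<in>?F. a i e * ?d e) = (\<Sum>e\<in>?F. a i e * d e)" by (intro sum.cong) auto
      finally show ?thesis .
    qed
    have "(\<Sum>e\<in>F. a i e * ?d e) = 0" if "i \<in> A" for i
    proof -
      have "0 = (\<Sum>e\<in>?F. a i e * d e - a i g / a j g * (a j e * d e))"
        using d(3) that by (simp add: algebra_simps)
      also have "\<dots> = (\<Sum>e\<in>?F. a i e * d e) - a i g / a j g * (\<Sum>e\<in>?F. a j e * d e)"
        by (simp only: sum_subtractf sum_distrib_left)
      also have "\<dots> = a i g * s + (\<Sum>e\<in>?F. a i e * d e)" unfolding s_def by simp
      finally show ?thesis using e by simp
    qed
    moreover have "(\<Sum>e\<in>F. a j e * ?d e) = 0"
      by (rule trans[OF e]) (use g in \<open>simp add: s_def\<close>)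
    moreover have "\<exists>e\<in>F. ?d e \<noteq> 0" using d(1) by auto
    moreover have "\<forall>e. e \<notin> F \<longrightarrow> ?d e = 0" using d(2) g by auto
    ultimately show ?thesis by (intro exI[of _ ?d]) auto
  qed
qed

subsection \<open>Polytopes\<close>

text \<open>A triple \<open>(s, B, b)\<close> stands for the linear constraint \<open>s * x(B) \<ge> b\<close>.\<close>

definition satisfies :: "('e \<Rightarrow> real) \<Rightarrow> real \<times> 'e set \<times> real \<Rightarrow> bool" where
  "satisfies x = (\<lambda>(s, B, b). b \<le> s * sum x B)"

definition tight :: "('e \<Rightarrow> real) \<Rightarrow> real \<times> 'e set \<times> real \<Rightarrow> bool" where
  "tight x = (\<lambda>(s, B, b). b = s * sum x B)"

text \<open>The ratio test: walk along \<open>d\<close> until the first constraint blocks. Tight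
  constraints stay tight because \<open>d\<close> sums to zero on them, and the blocking constraint
  is a new one because it had slack before.\<close>

lemma ray_to_boundary:
  fixes x d :: "'e \<Rightarrow> real"
  assumes "finite I" and feas: "\<forall>i\<in>I. satisfies x i"
    and keep: "\<forall>(s, B, b)\<in>I. tight x (s, B, b) \<longrightarrow> sum d B = 0"
    and "\<exists>(s, B, b)\<in>I. s * sum d B < 0"
  shows "\<exists>t>0. (\<forall>i\<in>I. satisfies (\<lambda>e. x e + t * d e) i) \<and>
    {i\<in>I. tight x i} \<subset> {i\<in>I. tight (\<lambda>e. x e + t * d e) i}"
proof -
  \<comment> \<open>\<open>r\<close> is the step length at which a constraint becomes tight; only
    the constraints in \<open>Q\<close> lose slack along \<open>d\<close>.\<close>
  define r :: "real \<times> 'e set \<times> real \<Rightarrow> real"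
    where "r = (\<lambda>(s, B, b). (s * sum x B - b) / - (s * sum d B))"
  define Q where "Q = {i\<in>I. case i of (s, B, b) \<Rightarrow> s * sum d B < 0}"
  have fQ: "finite Q" and Qne: "Q \<noteq> {}" using assms(1,4) unfolding Q_def by auto
  define t where "t = Min (r ` Q)"
  have "t \<in> r ` Q" unfolding t_def using fQ Qne by (intro Min_in) auto
  then obtain s0 B0 b0 where q: "(s0, B0, b0) \<in> Q" "t = r (s0, B0, b0)" by auto
  have tle: "t \<le> r i" if "i \<in> Q" for i unfolding t_def using fQ that by simp
  have lin: "s * sum (\<lambda>e. x e + t * d e) B = s * sum x B + t * (s * sum d B)" for s B
    by (simp add: sum.distrib sum_distrib_left algebra_simps)
  have q': "(s0, B0, b0) \<in> I" "s0 * sum d B0 < 0" using q(1) unfolding Q_def by auto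
  have nt: "\<not> tight x (s0, B0, b0)" using keep q' by fastforce
  then have "b0 < s0 * sum x B0" using feas q' unfolding satisfies_def tight_def by fastforce
  then have tpos: "t > 0" using q' unfolding q(2) r_def by (simp add: divide_pos_neg)
  have "satisfies (\<lambda>e. x e + t * d e) (s, B, b)" if i: "(s, B, b) \<in> I" for s B b
  proof (cases "s * sum d B < 0")
    case True
    then have "t \<le> (s * sum x B - b) / - (s * sum d B)" using tle[of "(s, B, b)"] i unfolding Q_def r_def by auto
    then have "t * - (s * sum d B) \<le> s * sum x B - b" using True by (simp only: pos_le_divide_eq neg_0_less_iff_less)
    then show ?thesis unfolding satisfies_def by (simp add: lin)
  next
    case False
    then have "0 \<le> t * (s * sum d B)" using tpos by simp
    moreover have "b \<le> s * sum x B" using feas i unfolding satisfies_def by fastforce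
    ultimately show ?thesis unfolding satisfies_def by (simp add: lin)
  qed
  then have 1: "\<forall>i\<in>I. satisfies (\<lambda>e. x e + t * d e) i" by auto
  have "tight (\<lambda>e. x e + t * d e) (s, B, b)" if "(s, B, b) \<in> I" "tight x (s, B, b)" for s B b
  proof -
    have "sum d B = 0" using keep that by fastforce
    then show ?thesis using that unfolding tight_def by (simp add: lin)
  qed
  then have 2: "{i\<in>I. tight x i} \<subseteq> {i\<in>I. tight (\<lambda>e. x e + t * d e) i}" by auto
  have "t = (s0 * sum x B0 - b0) / - (s0 * sum d B0)" unfolding q(2) r_def by simp
  then have "t * (s0 * sum d B0) = - (s0 * sum x B0 - b0)" using q'(2)
    by (metis less_irrefl minus_divide_divide minus_divide_left nonzero_eq_divide_eq minus_minus)
  then have "tight (\<lambda>e. x e + t * d e) (s0, B0, b0)" unfolding tight_def by (simp add: lin)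
  then have "{i\<in>I. tight x i} \<noteq> {i\<in>I. tight (\<lambda>e. x e + t * d e) i}" using nt q' by blast
  then show ?thesis using 1 2 tpos by blast
qed

text \<open>A feasible point that admits a direction preserving all tight constraints lies between two
  feasible points with more tight constraints.\<close>

lemma polytope_dominates:
  fixes x :: "'e \<Rightarrow> real"
  assumes "finite I" and box: "\<forall>e\<in>E. (1, {e}, 0) \<in> I \<and> (-1, {e}, -1) \<in> I"
    and step: "\<forall>x. (\<forall>i\<in>I. satisfies x i) \<longrightarrow> dominates E \<phi> X x \<or>
      (\<exists>d :: 'e \<Rightarrow> real. (\<exists>e\<in>E. d e \<noteq> 0) \<and> (\<forall>(s, B, b)\<in>I. tight x (s, B, b) \<longrightarrow> sum d B = 0))"
    and "\<forall>i\<in>I. satisfies x i"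
  shows "dominates E \<phi> X x"
  using assms(4)
\<comment> \<open>The measure is the number of constraints with slack.\<close>
proof (induction "card (I - {i\<in>I. tight x i})" arbitrary: x rule: less_induct)
  case less
  show ?case
  proof (cases "dominates E \<phi> X x")
    case False
    then have "\<exists>d :: 'e \<Rightarrow> real. (\<exists>e\<in>E. d e \<noteq> 0) \<and> (\<forall>(s, B, b)\<in>I. tight x (s, B, b) \<longrightarrow> sum d B = 0)"
      using step[THEN spec, THEN mp, OF less(2)] by (simp only: simp_thms)
    then obtain d :: "'e \<Rightarrow> real" where "\<exists>e\<in>E. d e \<noteq> 0"
      and d: "\<forall>(s, B, b)\<in>I. tight x (s, B, b) \<longrightarrow> sum d B = 0" by (elim exE conjE)
    then obtain e where e: "e \<in> E" "d e \<noteq> 0" by blast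
    have IH: "dominates E \<phi> X y" if "\<forall>i\<in>I. satisfies y i" "{i\<in>I. tight x i} \<subset> {i\<in>I. tight y i}" for y
      by (rule less(1)[OF _ that(1)], rule psubset_card_mono) (simp add: \<open>finite I\<close>, use that(2) in blast)
    have b: "(1, {e}, 0) \<in> I" "(-1, {e}, -1) \<in> I" using box e by auto
    \<comment> \<open>Whatever the sign of the direction at \<open>e\<close>, one of the two box
      bounds on \<open>e\<close> loses slack, so the ray cannot stay feasible forever.\<close>
    have ex: "\<exists>(s, B, b)\<in>I. s * sum d' B < 0" if "d' e \<noteq> 0" for d' :: "'e \<Rightarrow> real"
    proof (cases "d' e < 0")
      case True then show ?thesis using b(1) by (intro bexI[OF _ b(1)]) auto
    next
      case False then show ?thesis using that by (intro bexI[OF _ b(2)]) auto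
    qed
    obtain t where t: "t > 0" "\<forall>i\<in>I. satisfies (\<lambda>e. x e + t * d e) i"
      "{i\<in>I. tight x i} \<subset> {i\<in>I. tight (\<lambda>e. x e + t * d e) i}"
      using ray_to_boundary[OF \<open>finite I\<close> less(2) d ex[of d, OF e(2)]] by blast
    have d': "\<forall>(s, B, b)\<in>I. tight x (s, B, b) \<longrightarrow> sum (\<lambda>e. - d e) B = 0"
      using d by (simp add: sum_negf)
    have nz: "- d e \<noteq> 0" using e by simp
    obtain u where u: "u > 0" "\<forall>i\<in>I. satisfies (\<lambda>e. x e + u * - d e) i"
      "{i\<in>I. tight x i} \<subset> {i\<in>I. tight (\<lambda>e. x e + u * - d e) i}"
      using ray_to_boundary[OF \<open>finite I\<close> less(2) d' ex[of "\<lambda>e. - d e", OF nz]] by blast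
    \<comment> \<open>With this weight the displacements \<open>t * d\<close> and
      \<open>- u * d\<close> cancel.\<close>
    let ?l = "u / (u + t)"
    have l: "1 - ?l = t / (u + t)" using t u by (simp add: field_simps)
    show ?thesis
    proof (rule dominates_convex[OF IH[OF t(2,3)] IH[OF u(2,3)], of ?l])
      have "?l * (x f + t * d f) + (1 - ?l) * (x f + u * - d f) = x f" for f
        unfolding l using t(1) u(1) by (simp add: divide_simps) (simp add: algebra_simps)
      then show "\<forall>f\<in>E. ?l * (x f + t * d f) + (1 - ?l) * (x f + u * - d f) \<le> x f" by simp
    qed (use t u in auto)
  qed
qed

text \<open>Rows of size at least two make each family have at most half as many rows as
  \<open>F\<close> has elements, so there are at most \<open>card F\<close> equations. If there are
  that many, both families partition \<open>F\<close>, and one equation follows from the others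
  because both families add up to the same total.\<close>

lemma direction_two_partitions:
  fixes F :: "'e set"
  assumes "finite F" and "F \<noteq> {}" and "pairwise disjnt \<A>" and "pairwise disjnt \<C>"
    and rows: "\<forall>A\<in>\<A> \<union> \<C>. A \<subseteq> F \<and> card A \<ge> 2"
  shows "\<exists>d. (\<exists>e\<in>F. d e \<noteq> 0) \<and> (\<forall>e. e \<notin> F \<longrightarrow> d e = 0) \<and> (\<forall>A\<in>\<A> \<union> \<C>. sum d A = (0::real))"
proof -
  have fin: "finite \<R>" if "\<forall>A\<in>\<R>. A \<subseteq> F \<and> card A \<ge> 2" for \<R>
    by (rule finite_subset[of _ "Pow F"]) (use \<open>finite F\<close> that in auto)
  have half: "2 * card \<R> \<le> card (\<Union>\<R>) \<and> \<Union>\<R> \<subseteq> F" if "pairwise disjnt \<R>" "\<forall>A\<in>\<R>. A \<subseteq> F \<and> card A \<ge> 2" for \<R>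
  proof
    have "2 * card \<R> = (\<Sum>A\<in>\<R>. 2)" by simp
    also have "\<dots> \<le> sum card \<R>" using that(2) by (intro sum_mono) auto
    also have "\<dots> = card (\<Union>\<R>)"
      using that \<open>finite F\<close> by (intro card_Union_disjoint[symmetric]) (auto intro: rev_finite_subset)
    finally show "2 * card \<R> \<le> card (\<Union>\<R>)" .
    show "\<Union>\<R> \<subseteq> F" using that(2) by blast
  qed
  have hA: "2 * card \<A> \<le> card (\<Union>\<A>)" "\<Union>\<A> \<subseteq> F" using half[of \<A>] assms(3) rows by auto
  have hC: "2 * card \<C> \<le> card (\<Union>\<C>)" "\<Union>\<C> \<subseteq> F" using half[of \<C>] assms(4) rows by auto
  have cA: "card (\<Union>\<A>) \<le> card F" using hA \<open>finite F\<close> by (intro card_mono)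
  have cC: "card (\<Union>\<C>) \<le> card F" using hC \<open>finite F\<close> by (intro card_mono)
  have fA: "finite \<A>" and fC: "finite \<C>" using fin[of \<A>] fin[of \<C>] rows by auto
  have solve: "\<exists>d. (\<exists>e\<in>F. d e \<noteq> 0) \<and> (\<forall>e. e \<notin> F \<longrightarrow> d e = 0) \<and> (\<forall>A\<in>\<R>. sum d A = (0::real))"
    if R: "\<R> \<subseteq> \<A> \<union> \<C>" "card \<R> < card F" for \<R>
  proof -
    have "finite \<R>" by (rule finite_subset[OF R(1)]) (simp add: fA fC)
    from homogeneous_solution[OF this \<open>finite F\<close> R(2), of "\<lambda>A e. of_bool (e \<in> A)"]
    obtain d :: "'e \<Rightarrow> real" where d: "\<exists>e\<in>F. d e \<noteq> 0" "\<forall>e. e \<notin> F \<longrightarrow> d e = 0"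
      "\<forall>A\<in>\<R>. (\<Sum>e\<in>F. of_bool (e \<in> A) * d e) = 0" by (elim exE conjE)
    have "sum d A = 0" if "A \<in> \<R>" for A
    proof -
      have "A \<subseteq> F" using that R(1) rows by blast
      then have "F \<inter> A = A" by blast
      have "sum d (F \<inter> A) = (\<Sum>e\<in>F. if e \<in> A then d e else 0)"
        by (rule sum.inter_restrict[OF \<open>finite F\<close>])
      also have "\<dots> = (\<Sum>e\<in>F. of_bool (e \<in> A) * d e)" by (intro sum.cong) auto
      also have "\<dots> = 0" using d(3) that by blast
      finally show ?thesis using \<open>F \<inter> A = A\<close> by simp
    qed
    then show ?thesis using d(1,2) by (intro exI[of _ d]) simp
  qed
  show ?thesis
  proof (cases "card (\<A> \<union> \<C>) < card F")
    case True
    then show ?thesis by (intro solve) auto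
  next
    case False
    then have eq: "card F \<le> card \<A> + card \<C>" using card_Un_le[of \<A> \<C>] by linarith
    have "card (\<Union>\<A>) = card F" using eq hA(1) hC(1) cA cC by linarith
    then have UA: "\<Union>\<A> = F" using hA(2) \<open>finite F\<close> card_subset_eq by blast
    have "card (\<Union>\<C>) = card F" using eq hA(1) hC(1) cA cC by linarith
    then have UC: "\<Union>\<C> = F" using hC(2) \<open>finite F\<close> card_subset_eq by blast
    \<comment> \<open>Row \<open>R\<close> is dropped and recovered afterwards: \<open>\<C>\<close>
      gives total zero on \<open>F\<close>, and the other rows of \<open>\<A>\<close> contribute
      nothing.\<close>
    obtain R where R: "R \<in> \<A>" using UA assms(2) by blast
    have "card F > 0" using assms(1,2) by (simp add: card_gt_0_iff)
    have "card ((\<A> - {R}) \<union> \<C>) \<le> (card \<A> - 1) + card \<C>"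
      using card_Un_le[of "\<A> - {R}" \<C>] R fA by simp
    also have "\<dots> < card F"
      using eq hA(1) hC(1) cA cC \<open>card F > 0\<close> by linarith
    finally obtain d :: "'e \<Rightarrow> real" where d: "\<exists>e\<in>F. d e \<noteq> 0" "\<forall>e. e \<notin> F \<longrightarrow> d e = 0"
      "\<forall>A\<in>(\<A> - {R}) \<union> \<C>. sum d A = 0" using solve[of "(\<A> - {R}) \<union> \<C>"] by blast
    have U: "sum d (\<Union>\<R>) = (\<Sum>A\<in>\<R>. sum d A)" if "pairwise disjnt \<R>" "\<R> \<subseteq> \<A> \<union> \<C>" for \<R>
    proof -
      have "\<forall>A\<in>\<R>. A \<subseteq> F" using that(2) rows by blast
      then have "\<forall>A\<in>\<R>. finite A" using finite_subset[OF _ \<open>finite F\<close>] by simp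
      then show ?thesis using that(1) by (subst sum.Union_disjoint) (auto simp: pairwise_def disjnt_def)
    qed
    have "sum d F = (\<Sum>A\<in>\<C>. sum d A)" using U[of \<C>] assms(4) UC by simp
    also have "\<dots> = 0" using d(3) by simp
    finally have 1: "sum d F = 0" .
    have "sum d F = (\<Sum>A\<in>\<A>. sum d A)" using U[of \<A>] assms(3) UA by simp
    also have "\<dots> = sum d R + (\<Sum>A\<in>\<A> - {R}. sum d A)" using R fA by (simp add: sum.remove)
    also have "\<dots> = sum d R" using d(3) by simp
    finally have "sum d R = 0" using 1 by simp
    then show ?thesis using d by (intro exI[of _ d]) auto
  qed
qed

subsection \<open>Supermodular functions and partition matroids\<close>

abbreviation incidence :: "'e set \<Rightarrow> 'e \<Rightarrow> real" where
  "incidence J e \<equiv> of_bool (e \<in> J)"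

lemma sum_incidence: "finite B \<Longrightarrow> (\<Sum>e\<in>B. incidence J e) = card (J \<inter> B)"
  by (simp add: Int_commute)

lemma sum_affine_incidence:
  "finite S \<Longrightarrow> (\<Sum>e\<in>S. a + b * incidence J e) = a * card S + b * card (J \<inter> S)"
  by (simp only: sum.distrib sum_distrib_left[symmetric] sum_incidence) simp

text \<open>A single fractional summand among integers would make the total fractional.\<close>

lemma fractional_card_ge_2:
  fixes y :: "'e \<Rightarrow> real"
  assumes "finite S" and "sum y S \<in> \<int>" and "\<forall>e\<in>S - F. y e \<in> \<int>" and "\<forall>e\<in>F. y e \<notin> \<int>" and "S \<inter> F \<noteq> {}"
  shows "card (S \<inter> F) \<ge> 2"
proof (rule ccontr)
  assume "\<not> card (S \<inter> F) \<ge> 2"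
  moreover have "card (S \<inter> F) \<noteq> 0" using assms(1,5) by simp
  ultimately have "card (S \<inter> F) = 1" by linarith
  then obtain e where e: "S \<inter> F = {e}" using card_1_singletonE by blast
  then have "sum y S = y e + sum y (S - {e})" using assms(1) by (intro sum.remove) auto
  moreover have "sum y (S - {e}) \<in> \<int>" using e assms(3) by (intro Ints_sum) blast
  ultimately have "y e \<in> \<int>" using assms(2) by (metis Ints_diff add_diff_cancel_right')
  then show False using e assms(4) by blast
qed

lemma finite_Union_closed:
  assumes "finite \<S>" and "\<S> \<subseteq> \<T>" and "{} \<in> \<T>" and "\<forall>A\<in>\<T>. \<forall>B\<in>\<T>. A \<union> B \<in> \<T>"
  shows "\<Union>\<S> \<in> \<T>"
  using assms(1,2) by (induction rule: finite_induct) (use assms(3,4) in simp_all)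

lemma finite_Inter_closed:
  assumes "finite \<S>" and "\<S> \<noteq> {}" and "\<S> \<subseteq> \<T>" and "\<forall>A\<in>\<T>. \<forall>B\<in>\<T>. A \<inter> B \<in> \<T>"
  shows "\<Inter>\<S> \<in> \<T>"
  using assms(1,2,3) by (induction rule: finite_ne_induct) (use assms(4) in simp_all)

text \<open>Tight sets form a lattice, and preserving the sums over its atoms preserves all tight
  sets. Atoms and classes of \<open>\<C>\<close> both have integral sums, so each of them that meets
  the fractional support meets it at least twice. This gives two families of disjoint rows, as in
  \<open>direction_two_partitions\<close>.\<close>

lemma supermodular_direction:
  fixes p :: "'e set \<Rightarrow> int" and y :: "'e \<Rightarrow> real"
  assumes "finite E" and p0: "p {} = 0"
    and super: "\<forall>A B. A \<subseteq> E \<longrightarrow> B \<subseteq> E \<longrightarrow> p A + p B \<le> p (A \<union> B) + p (A \<inter> B)"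
    and disj: "pairwise disjnt \<C>" and sub: "\<forall>C\<in>\<C>. C \<subseteq> E"
    and ge: "\<forall>B. B \<subseteq> E \<longrightarrow> p B \<le> sum y B" and one: "\<forall>C\<in>\<C>. sum y C = 1"
    and frac: "\<exists>e\<in>E. y e \<notin> \<int>"
  shows "\<exists>d. (\<exists>e\<in>E. d e \<noteq> 0) \<and> (\<forall>e. y e \<in> \<int> \<longrightarrow> d e = (0::real)) \<and>
    (\<forall>B. B \<subseteq> E \<longrightarrow> sum y B = p B \<longrightarrow> sum d B = 0) \<and> (\<forall>C\<in>\<C>. sum d C = 0)"
proof -
  define F where "F = {e\<in>E. y e \<notin> \<int>}"
  define \<T> where "\<T> = {B. B \<subseteq> E \<and> sum y B = p B}"
  have fF: "finite F" and Fne: "F \<noteq> {}" unfolding F_def using \<open>finite E\<close> frac by auto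
  have fS: "finite B" if "B \<subseteq> E" for B using that \<open>finite E\<close> by (rule finite_subset)
  have fT: "finite \<T>" unfolding \<T>_def using \<open>finite E\<close> by simp
  \<comment> \<open>Uncrossing: \<open>p\<close> is supermodular and the sum of \<open>y\<close> is
    modular, so no slack is left at the union or at the intersection.\<close>
  have closed: "A \<union> B \<in> \<T> \<and> A \<inter> B \<in> \<T>" if AB: "A \<in> \<T>" "B \<in> \<T>" for A B
  proof -
    have AB': "A \<subseteq> E" "B \<subseteq> E" "sum y A = p A" "sum y B = p B" using AB unfolding \<T>_def by auto
    have 1: "sum y (A \<union> B) + sum y (A \<inter> B) = sum y A + sum y B"
      using fS AB' by (intro sum.union_inter) auto
    have "real_of_int (p A) + p B \<le> p (A \<union> B) + p (A \<inter> B)"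
      using super AB' by (metis of_int_add of_int_le_iff)
    moreover have "p (A \<union> B) \<le> sum y (A \<union> B)" using ge AB' by simp
    moreover have "p (A \<inter> B) \<le> sum y (A \<inter> B)" using ge AB' by (simp add: le_infI1)
    ultimately have "sum y (A \<union> B) = p (A \<union> B)" "sum y (A \<inter> B) = p (A \<inter> B)"
      using 1 AB'(3,4) by linarith+
    then show ?thesis using AB' unfolding \<T>_def by auto
  qed
  have e0: "{} \<in> \<T>" unfolding \<T>_def using p0 by simp
  have two: "card (S \<inter> F) \<ge> 2" if "S \<subseteq> E" "sum y S \<in> \<int>" "S \<inter> F \<noteq> {}" for S
    using that by (intro fractional_card_ge_2[of S y]) (auto simp: F_def fS)
  define atom where "atom e = {f\<in>E. \<forall>B\<in>\<T>. e \<in> B \<longleftrightarrow> f \<in> B}" for e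
  have atom_int: "sum y (atom e) \<in> \<int>" if e: "e \<in> \<Union>\<T>" for e
  proof -
    \<comment> \<open>\<open>U\<close> is the least tight set containing \<open>e\<close>, and
      \<open>L\<close> the largest tight subset of \<open>U\<close> avoiding \<open>e\<close>. The
      atom is their difference, hence its sum is integral.\<close>
    define U where "U = \<Inter>{B\<in>\<T>. e \<in> B}"
    define L where "L = \<Union>{B\<in>\<T>. B \<subseteq> U \<and> e \<notin> B}"
    have U: "U \<in> \<T>" unfolding U_def by (rule finite_Inter_closed) (use fT e closed in auto)
    have L: "L \<in> \<T>" unfolding L_def by (rule finite_Union_closed) (use fT e0 closed in auto)
    have LU: "L \<subseteq> U" unfolding L_def by blast
    have UE: "U \<subseteq> E" using U unfolding \<T>_def by simp
    have "atom e = U - L"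
    proof
      show "atom e \<subseteq> U - L" unfolding atom_def U_def L_def by blast
      show "U - L \<subseteq> atom e"
      proof
        fix f assume f: "f \<in> U - L"
        have "e \<in> B \<longleftrightarrow> f \<in> B" if B: "B \<in> \<T>" for B
        proof
          assume "e \<in> B" then show "f \<in> B" using f B unfolding U_def by blast
        next
          assume fB: "f \<in> B"
          show "e \<in> B"
          proof (rule ccontr)
            assume "e \<notin> B"
            then have "B \<inter> U \<in> {B\<in>\<T>. B \<subseteq> U \<and> e \<notin> B}" using closed[OF B U] by simp
            then have "f \<in> L" unfolding L_def using f fB by blast
            then show False using f by blast
          qed
        qed
        then show "f \<in> atom e" unfolding atom_def using f UE by blast
      qed
    qed
    then have "sum y (atom e) = sum y U - sum y L"
      using LU fS[OF UE] by (simp add: sum_diff)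
    then show ?thesis using U L unfolding \<T>_def by simp
  qed
  \<comment> \<open>The rows are the traces of atoms and classes on the fractional support.
    Fractional elements outside every tight set need no row in \<open>\<A>\<close>.\<close>
  define \<A> where "\<A> = (\<lambda>e. atom e \<inter> F) ` (F \<inter> \<Union>\<T>)"
  define \<D> where "\<D> = (\<lambda>C. C \<inter> F) ` {C\<in>\<C>. C \<inter> F \<noteq> {}}"
  have atom_self: "e \<in> atom e" if "e \<in> E" for e using that unfolding atom_def by simp
  have atom_disj: "atom e = atom f \<or> atom e \<inter> atom f = {}" for e f
    unfolding atom_def by (cases "\<forall>B\<in>\<T>. e \<in> B \<longleftrightarrow> f \<in> B") auto
  have dA: "pairwise disjnt \<A>"
    unfolding \<A>_def pairwise_def disjnt_def
  proof (intro ballI impI)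
    fix A B assume "A \<in> (\<lambda>e. atom e \<inter> F) ` (F \<inter> \<Union>\<T>)" "B \<in> (\<lambda>e. atom e \<inter> F) ` (F \<inter> \<Union>\<T>)" "A \<noteq> B"
    then obtain e f where "A = atom e \<inter> F" "B = atom f \<inter> F" "atom e \<noteq> atom f" by blast
    then show "A \<inter> B = {}" using atom_disj[of e f] by blast
  qed
  have dD: "pairwise disjnt \<D>"
    unfolding \<D>_def pairwise_def disjnt_def
  proof (intro ballI impI)
    fix A B assume "A \<in> (\<lambda>C. C \<inter> F) ` {C\<in>\<C>. C \<inter> F \<noteq> {}}" "B \<in> (\<lambda>C. C \<inter> F) ` {C\<in>\<C>. C \<inter> F \<noteq> {}}" "A \<noteq> B"
    then obtain C D where "C \<in> \<C>" "D \<in> \<C>" "A = C \<inter> F" "B = D \<inter> F" "C \<noteq> D" by blast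
    moreover from this have "C \<inter> D = {}" using disj unfolding pairwise_def disjnt_def by simp
    ultimately show "A \<inter> B = {}" by blast
  qed
  have rowsA: "A \<subseteq> F \<and> card A \<ge> 2" if "A \<in> \<A>" for A
  proof -
    obtain e where e: "e \<in> F" "e \<in> \<Union>\<T>" "A = atom e \<inter> F"
      using \<open>A \<in> \<A>\<close> unfolding \<A>_def by blast
    have "e \<in> E" using e unfolding F_def by simp
    then have "atom e \<inter> F \<noteq> {}" using atom_self e(1) by blast
    moreover have "atom e \<subseteq> E" unfolding atom_def by blast
    ultimately show ?thesis using two atom_int e by simp
  qed
  have rowsD: "D \<subseteq> F \<and> card D \<ge> 2" if "D \<in> \<D>" for D
  proof -
    obtain C where C: "C \<in> \<C>" "C \<inter> F \<noteq> {}" "D = C \<inter> F"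
      using \<open>D \<in> \<D>\<close> unfolding \<D>_def by blast
    then show ?thesis using two[of C] sub one by simp
  qed
  have rows: "\<forall>A\<in>\<A> \<union> \<D>. A \<subseteq> F \<and> card A \<ge> 2" using rowsA rowsD by blast
  obtain d :: "'e \<Rightarrow> real" where d: "\<exists>e\<in>F. d e \<noteq> 0" "\<forall>e. e \<notin> F \<longrightarrow> d e = 0"
    "\<forall>A\<in>\<A> \<union> \<D>. sum d A = 0" using direction_two_partitions[OF fF Fne dA dD rows] by (elim exE conjE)
  have restr: "sum d S = sum d (S \<inter> F)" if "S \<subseteq> E" for S
    using d(2) fS[OF that] by (intro sum.mono_neutral_right) auto
  have "sum d B = 0" if B: "B \<subseteq> E" "sum y B = p B" for B
  proof -
    have BT: "B \<in> \<T>" using B unfolding \<T>_def by simp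
    let ?\<R> = "(\<lambda>e. atom e \<inter> F) ` (B \<inter> F)"
    have RA: "?\<R> \<subseteq> \<A>" unfolding \<A>_def using BT by blast
    have "B \<inter> F = \<Union>?\<R>"
    proof
      show "B \<inter> F \<subseteq> \<Union>?\<R>" using atom_self unfolding F_def by blast
      show "\<Union>?\<R> \<subseteq> B \<inter> F" using BT unfolding atom_def by blast
    qed
    also have "sum d (\<Union>?\<R>) = (\<Sum>A\<in>?\<R>. sum d A)"
    proof -
      have "\<forall>A\<in>?\<R>. \<forall>B\<in>?\<R>. A \<noteq> B \<longrightarrow> A \<inter> B = {}"
        using pairwise_subset[OF dA RA] unfolding pairwise_def disjnt_def .
      from sum.Union_disjoint[OF _ this, of d] show ?thesis using fF by simp
    qed
    also have "\<dots> = 0" using d(3) RA by (intro sum.neutral) blast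
    finally show ?thesis using restr[OF B(1)] by simp
  qed
  moreover have "sum d C = 0" if "C \<in> \<C>" for C
  proof (cases "C \<inter> F = {}")
    case True
    then show ?thesis using restr[of C] sub that by simp
  next
    case False
    then have "C \<inter> F \<in> \<D>" unfolding \<D>_def using that by blast
    then show ?thesis using restr[of C] sub that d(3) by simp
  qed
  moreover have "\<exists>e\<in>E. d e \<noteq> 0" using d(1) unfolding F_def by blast
  moreover have "\<forall>e. y e \<in> \<int> \<longrightarrow> d e = 0" using d(2) unfolding F_def by blast
  ultimately show ?thesis by (intro exI[of _ d]) simp
qed

text \<open>Integrality of the intersection of a supermodular covering polytope with a partition matroid.\<close>

lemma supermodular_dominates:
  fixes p :: "'e set \<Rightarrow> int" and x :: "'e \<Rightarrow> real"
  assumes "finite E" and p0: "p {} = 0"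
    and super: "\<forall>A B. A \<subseteq> E \<longrightarrow> B \<subseteq> E \<longrightarrow> p A + p B \<le> p (A \<union> B) + p (A \<inter> B)"
    and disj: "pairwise disjnt \<C>" and sub: "\<forall>C\<in>\<C>. C \<subseteq> E"
    and box: "\<forall>e\<in>E. 0 \<le> x e \<and> x e \<le> 1"
    and ge: "\<forall>B. B \<subseteq> E \<longrightarrow> p B \<le> sum x B" and one: "\<forall>C\<in>\<C>. sum x C = 1"
  shows "dominates E incidence
    {J. J \<subseteq> E \<and> (\<forall>B. B \<subseteq> E \<longrightarrow> p B \<le> card (J \<inter> B)) \<and> (\<forall>C\<in>\<C>. card (J \<inter> C) = 1)} x"
    (is "dominates E incidence ?X x")
proof -
  \<comment> \<open>Box bounds, covering constraints, and each equation as two opposite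
    inequalities.\<close>
  define I where "I = (\<lambda>e. (1::real, {e}, 0::real)) ` E \<union> (\<lambda>e. (-1, {e}, -1)) ` E
    \<union> (\<lambda>B. (1, B, real_of_int (p B))) ` Pow E \<union> (\<lambda>C. (1, C, 1)) ` \<C> \<union> (\<lambda>C. (-1, C, -1)) ` \<C>"
  have "finite \<C>" by (rule finite_subset[of _ "Pow E"]) (use sub \<open>finite E\<close> in auto)
  then have fI: "finite I" unfolding I_def using \<open>finite E\<close> by simp
  have feas: "(\<forall>i\<in>I. satisfies y i) \<longleftrightarrow> (\<forall>e\<in>E. 0 \<le> y e \<and> y e \<le> 1) \<and>
    (\<forall>B. B \<subseteq> E \<longrightarrow> p B \<le> sum y B) \<and> (\<forall>C\<in>\<C>. sum y C = 1)" for y :: "'e \<Rightarrow> real"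
    unfolding I_def satisfies_def by (auto simp: ball_Un intro: order_antisym)
  show ?thesis
  proof (rule polytope_dominates[OF fI])
    show "\<forall>e\<in>E. (1, {e}, 0) \<in> I \<and> (-1, {e}, -1) \<in> I" unfolding I_def by blast
    show "\<forall>i\<in>I. satisfies x i" unfolding feas using box ge one by blast
    show "\<forall>y. (\<forall>i\<in>I. satisfies y i) \<longrightarrow> dominates E incidence ?X y \<or>
      (\<exists>d :: 'e \<Rightarrow> real. (\<exists>e\<in>E. d e \<noteq> 0) \<and> (\<forall>(s, B, b)\<in>I. tight y (s, B, b) \<longrightarrow> sum d B = 0))"
    proof (intro allI impI)
      fix y :: "'e \<Rightarrow> real" assume "\<forall>i\<in>I. satisfies y i"
      then have y: "\<forall>e\<in>E. 0 \<le> y e \<and> y e \<le> 1" "\<forall>B. B \<subseteq> E \<longrightarrow> p B \<le> sum y B"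
        "\<forall>C\<in>\<C>. sum y C = 1" unfolding feas by blast+
      show "dominates E incidence ?X y \<or>
        (\<exists>d :: 'e \<Rightarrow> real. (\<exists>e\<in>E. d e \<noteq> 0) \<and> (\<forall>(s, B, b)\<in>I. tight y (s, B, b) \<longrightarrow> sum d B = 0))"
      proof (cases "\<exists>e\<in>E. y e \<notin> \<int>")
        case True
        from supermodular_direction[OF \<open>finite E\<close> p0 super disj sub y(2,3) True]
        obtain d :: "'e \<Rightarrow> real" where d: "\<exists>e\<in>E. d e \<noteq> 0" "\<forall>e. y e \<in> \<int> \<longrightarrow> d e = 0"
          "\<forall>B. B \<subseteq> E \<longrightarrow> sum y B = p B \<longrightarrow> sum d B = 0" "\<forall>C\<in>\<C>. sum d C = 0" by (elim exE conjE)
        \<comment> \<open>A tight box bound means an integral coordinate, and \<open>d\<close>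
          vanishes there.\<close>
        have "\<forall>(s, B, b)\<in>I. tight y (s, B, b) \<longrightarrow> sum d B = 0"
          unfolding I_def tight_def using d(2,3,4) by (auto simp: ball_Un)
        then show ?thesis using d(1) by blast
      next
        case False
        \<comment> \<open>Integral coordinates between 0 and 1 make \<open>y\<close> itself an
          incidence vector.\<close>
        define J where "J = {e\<in>E. y e = 1}"
        have y01: "y e = incidence J e" if "e \<in> E" for e
        proof -
          obtain k where k: "y e = of_int k" using False \<open>e \<in> E\<close> Ints_cases by blast
          then have "k = 0 \<or> k = 1" using y(1) that by fastforce
          then show ?thesis using k that unfolding J_def by auto
        qed
        have sy: "sum y B = card (J \<inter> B)" if "B \<subseteq> E" for B
        proof -
          have "sum y B = (\<Sum>e\<in>B. incidence J e)" using y01 that by (intro sum.cong) auto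
          also have "\<dots> = card (J \<inter> B)" using finite_subset[OF that \<open>finite E\<close>] by (rule sum_incidence)
          finally show ?thesis .
        qed
        have "p B \<le> card (J \<inter> B)" if "B \<subseteq> E" for B
          using y(2) that sy[OF that] by (metis of_int_le_iff of_int_of_nat_eq)
        moreover have "card (J \<inter> C) = 1" if "C \<in> \<C>" for C
          using y(3) that sy[of C] sub by (metis of_nat_1 of_nat_eq_iff)
        ultimately have "J \<in> ?X" unfolding J_def by blast
        then have "dominates E incidence ?X y" by (rule dominates.base) (simp add: y01)
        then show ?thesis ..
      qed
    qed
  qed
qed

subsection \<open>Joins\<close>

text \<open>Two distributions whose labels have equal marginals can be realised jointly on pairs
  with equal labels: given the label, the two components are chosen independently.\<close>

lemma coupling:
  fixes l1 :: "'a \<Rightarrow> real" and l2 :: "'b \<Rightarrow> real"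
  assumes fin: "finite T1" "finite T2" and nn: "\<forall>a\<in>T1. l1 a \<ge> 0" "\<forall>b\<in>T2. l2 b \<ge> 0"
    and marg: "\<forall>c\<in>D. sum l1 {a\<in>T1. g1 a = c} = m c" "\<forall>c\<in>D. sum l2 {b\<in>T2. g2 b = c} = m c"
    and D: "g1 ` T1 \<subseteq> D" "g2 ` T2 \<subseteq> D"
  defines "I \<equiv> SIGMA a:T1. {b\<in>T2. g1 a = g2 b}"
  shows "\<exists>w. (\<forall>i\<in>I. w i \<ge> 0) \<and> (\<forall>h. (\<Sum>i\<in>I. w i * h (fst i)) = (\<Sum>a\<in>T1. l1 a * h a)) \<and>
    (\<forall>h. (\<Sum>i\<in>I. w i * h (snd i)) = (\<Sum>b\<in>T2. l2 b * h b))"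
proof -
  \<comment> \<open>A label of mass 0 gives division by zero, hence weight 0. This is the right
    value, since \<open>z1\<close> and \<open>z2\<close> show that nothing of that label carries
    weight.\<close>
  define w where "w i = l1 (fst i) * l2 (snd i) / m (g1 (fst i))" for i
  have mnn: "m c \<ge> 0" if "c \<in> D" for c
  proof -
    have "m c = sum l1 {a\<in>T1. g1 a = c}" using marg that by simp
    also have "\<dots> \<ge> 0" using nn by (intro sum_nonneg) auto
    finally show ?thesis .
  qed
  have z1: "l1 a = 0" if "a \<in> T1" "m (g1 a) = 0" for a
  proof -
    have "sum l1 {a'\<in>T1. g1 a' = g1 a} = 0" using marg(1) D(1) that by auto
    then have "\<forall>a'\<in>{a'\<in>T1. g1 a' = g1 a}. l1 a' = 0"
      using fin nn by (subst (asm) sum_nonneg_eq_0_iff) auto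
    then show ?thesis using that by simp
  qed
  have z2: "l2 b = 0" if "b \<in> T2" "m (g2 b) = 0" for b
  proof -
    have "sum l2 {b'\<in>T2. g2 b' = g2 b} = 0" using marg(2) D(2) that by auto
    then have "\<forall>b'\<in>{b'\<in>T2. g2 b' = g2 b}. l2 b' = 0"
      using fin nn by (subst (asm) sum_nonneg_eq_0_iff) auto
    then show ?thesis using that by simp
  qed
  have "\<forall>i\<in>I. w i \<ge> 0" unfolding I_def w_def using nn mnn D
    by (auto intro!: divide_nonneg_nonneg mult_nonneg_nonneg)
  moreover have "(\<Sum>i\<in>I. w i * h (fst i)) = (\<Sum>a\<in>T1. l1 a * h a)" for h
  proof -
    have "(\<Sum>i\<in>I. w i * h (fst i)) = (\<Sum>a\<in>T1. \<Sum>b\<in>{b\<in>T2. g1 a = g2 b}. w (a, b) * h a)"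
      unfolding I_def using fin by (subst sum.Sigma) (auto simp: case_prod_unfold)
    also have "\<dots> = (\<Sum>a\<in>T1. l1 a * h a)"
    proof (rule sum.cong[OF refl])
      fix a assume a: "a \<in> T1"
      have "(\<Sum>b\<in>{b\<in>T2. g1 a = g2 b}. w (a, b) * h a)
          = (\<Sum>b\<in>{b\<in>T2. g1 a = g2 b}. l2 b) * (l1 a * h a / m (g1 a))"
        unfolding w_def sum_distrib_right by (intro sum.cong) auto
      also have "(\<Sum>b\<in>{b\<in>T2. g1 a = g2 b}. l2 b) = m (g1 a)"
        using marg(2) D(1) a by (simp add: eq_commute image_subset_iff)
      finally show "(\<Sum>b\<in>{b\<in>T2. g1 a = g2 b}. w (a, b) * h a) = l1 a * h a" using z1[OF a] by auto
    qed
    finally show ?thesis .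
  qed
  moreover have "(\<Sum>i\<in>I. w i * h (snd i)) = (\<Sum>b\<in>T2. l2 b * h b)" for h
  proof -
    have "(\<Sum>i\<in>I. w i * h (snd i)) = (\<Sum>a\<in>T1. \<Sum>b\<in>{b\<in>T2. g1 a = g2 b}. w (a, b) * h b)"
      unfolding I_def using fin by (subst sum.Sigma) (auto simp: case_prod_unfold)
    also have "\<dots> = (\<Sum>b\<in>T2. \<Sum>a\<in>{a\<in>T1. g1 a = g2 b}. w (a, b) * h b)"
      by (rule sum.swap_restrict[OF fin])
    also have "\<dots> = (\<Sum>b\<in>T2. l2 b * h b)"
    proof (rule sum.cong[OF refl])
      fix b assume b: "b \<in> T2"
      have "(\<Sum>a\<in>{a\<in>T1. g1 a = g2 b}. w (a, b) * h b)
          = (\<Sum>a\<in>{a\<in>T1. g1 a = g2 b}. l1 a) * (l2 b * h b / m (g2 b))"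
        unfolding w_def sum_distrib_right by (intro sum.cong) auto
      also have "(\<Sum>a\<in>{a\<in>T1. g1 a = g2 b}. l1 a) = m (g2 b)"
        using marg(1) D(2) b by (simp add: image_subset_iff)
      finally show "(\<Sum>a\<in>{a\<in>T1. g1 a = g2 b}. w (a, b) * h b) = l2 b * h b" using z2[OF b] by auto
    qed
    finally show ?thesis .
  qed
  ultimately show ?thesis by (intro exI[of _ w]) simp
qed

locale finite_multigraph =
  fixes V :: "'v set" and E :: "'e set" and ends :: "'e \<Rightarrow> 'v set"
  assumes multigraph: "multigraph V E ends"
begin

section \<open>Cuts and their parity\<close>

abbreviation cut :: "'v set \<Rightarrow> 'e set" where "cut \<equiv> cut_edges E ends"

lemma finite_V: "finite V" and finite_E: "finite E" and ends_subset: "e \<in> E \<Longrightarrow> ends e \<subseteq> V"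
  and card_ends: "e \<in> E \<Longrightarrow> card (ends e) = 2"
  using multigraph unfolding multigraph_def by auto

lemma finite_ends: "e \<in> E \<Longrightarrow> finite (ends e)"
  using card_ends by (metis card.infinite zero_neq_numeral)

lemma cut_subset: "cut U \<subseteq> E"
  unfolding cut_edges_def by blast

lemma finite_cut: "finite (cut U)"
  using finite_subset[OF cut_subset finite_E] .

lemma cut_iff: "e \<in> cut U \<longleftrightarrow> e \<in> E \<and> (\<exists>u v. ends e = {u, v} \<and> u \<in> U \<and> v \<notin> U)"
proof
  assume e: "e \<in> cut U"
  then have E: "e \<in> E" and 1: "card (ends e \<inter> U) = 1" unfolding cut_edges_def by auto
  obtain a b where ab: "ends e = {a, b}" "a \<noteq> b" using card_ends[OF E] card_2_iff by metis
  consider "a \<in> U" "b \<notin> U" | "b \<in> U" "a \<notin> U" using 1 ab by (cases "a \<in> U"; cases "b \<in> U") auto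
  then show "e \<in> E \<and> (\<exists>u v. ends e = {u, v} \<and> u \<in> U \<and> v \<notin> U)"
    using E ab by cases (auto intro: exI[of _ b] exI[of _ a])
next
  assume "e \<in> E \<and> (\<exists>u v. ends e = {u, v} \<and> u \<in> U \<and> v \<notin> U)"
  then obtain u v where "e \<in> E" "ends e = {u, v}" "u \<in> U" "v \<notin> U" by blast
  then have "e \<in> E" "ends e \<inter> U = {u}" by auto
  then show "e \<in> cut U" unfolding cut_edges_def by simp
qed

lemma cut_complement: "cut (V - U) = cut U"
proof -
  have "e \<in> cut (V - U) \<longleftrightarrow> e \<in> cut U" for e
    unfolding cut_iff using ends_subset[of e] by (auto simp: insert_commute)
  then show ?thesis by blast
qed

lemma cut_empty: "cut {} = {}" and cut_V: "cut V = {}"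
  using cut_complement[of "{}"] unfolding cut_edges_def by auto

text \<open>Edges inside \<open>U\<close> count twice, so modulo two only the cut edges remain. The
  right side is additive over disjoint sets, which gives additivity of cut parities.\<close>

lemma odd_card_cut:
  assumes "J \<subseteq> E"
  shows "odd (card (J \<inter> cut U)) \<longleftrightarrow> odd (\<Sum>e\<in>J. card (ends e \<inter> U))"
proof -
  have fJ: "finite J" using finite_subset[OF assms finite_E] .
  have "odd (card (ends e \<inter> U)) \<longleftrightarrow> e \<in> cut U" if "e \<in> J" for e
  proof -
    have e: "e \<in> E" using that assms by blast
    then have "card (ends e \<inter> U) \<le> 2" using card_mono[OF finite_ends[OF e], of "ends e \<inter> U"] card_ends by simp
    then consider "card (ends e \<inter> U) = 0" | "card (ends e \<inter> U) = 1" | "card (ends e \<inter> U) = 2" by linarith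
    then show ?thesis using e unfolding cut_edges_def by cases simp_all
  qed
  then have "{e\<in>J. odd (card (ends e \<inter> U))} = J \<inter> cut U" by blast
  then show ?thesis using even_sum_iff[OF fJ, of "\<lambda>e. card (ends e \<inter> U)"] by simp
qed

lemma odd_card_cut_Un:
  assumes "J \<subseteq> E" and "U \<inter> W = {}"
  shows "odd (card (J \<inter> cut (U \<union> W))) \<longleftrightarrow> (odd (card (J \<inter> cut U)) \<longleftrightarrow> even (card (J \<inter> cut W)))"
proof -
  have "card (ends e \<inter> (U \<union> W)) = card (ends e \<inter> U) + card (ends e \<inter> W)" if "e \<in> J" for e
    unfolding Int_Un_distrib using assms that finite_ends by (intro card_Un_disjoint) auto
  then have "(\<Sum>e\<in>J. card (ends e \<inter> (U \<union> W))) = (\<Sum>e\<in>J. card (ends e \<inter> U)) + (\<Sum>e\<in>J. card (ends e \<inter> W))"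
    by (simp add: sum.distrib)
  then show ?thesis using odd_card_cut[OF assms(1)] by auto
qed

text \<open>A partition \<open>\<P>\<close> of the vertex set plays the role of the graph in which every part is contracted
  to a single vertex.\<close>

definition vertex_partition :: "'v set set \<Rightarrow> bool" where
  "vertex_partition \<P> \<longleftrightarrow> \<Union>\<P> = V \<and> pairwise disjnt \<P>"

text \<open>The joins of the contracted graph: a part is a terminal when it contains an odd number
  of vertices of \<open>W\<close>.\<close>

definition joins :: "'v set set \<Rightarrow> 'v set \<Rightarrow> 'e set set" where
  "joins \<P> W = {J. J \<subseteq> E \<and> (\<forall>P\<in>\<P>. odd (card (J \<inter> cut P)) \<longleftrightarrow> odd (card (P \<inter> W)))}"

text \<open>The odd-cut inequalities of Edmonds and Johnson. The upper bounds are added to obtain a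
  bounded polytope, as \<open>polytope_dominates\<close> requires.\<close>

definition join_vector :: "'v set set \<Rightarrow> 'v set \<Rightarrow> ('e \<Rightarrow> real) \<Rightarrow> bool" where
  "join_vector \<P> W z \<longleftrightarrow> (\<forall>e\<in>E. 0 \<le> z e \<and> z e \<le> 1) \<and>
    (\<forall>\<Q>. \<Q> \<subseteq> \<P> \<longrightarrow> odd (card (\<Union>\<Q> \<inter> W)) \<longrightarrow> 1 \<le> sum z (cut (\<Union>\<Q>)))"

section \<open>Contraction of parts and gluing along a tight cut\<close>

definition merge :: "'v set set \<Rightarrow> 'v set set \<Rightarrow> 'v set set" where
  "merge \<P> \<Q> = insert (\<Union>\<Q>) (\<P> - \<Q>)"

lemma joins_subset: "J \<in> joins \<P> W \<Longrightarrow> J \<subseteq> E"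
  unfolding joins_def by simp

lemma joins_odd: "J \<in> joins \<P> W \<Longrightarrow> P \<in> \<P> \<Longrightarrow> odd (card (J \<inter> cut P)) \<longleftrightarrow> odd (card (P \<inter> W))"
  unfolding joins_def by simp

lemma joinsI: "J \<subseteq> E \<Longrightarrow> (\<And>P. P \<in> \<P> \<Longrightarrow> odd (card (J \<inter> cut P)) \<longleftrightarrow> odd (card (P \<inter> W))) \<Longrightarrow> J \<in> joins \<P> W"
  unfolding joins_def by simp

lemma finite_partition: "vertex_partition \<P> \<Longrightarrow> finite \<P>"
  unfolding vertex_partition_def by (rule finite_subset[of _ "Pow V"]) (use finite_V in auto)

lemma disjoint_parts: "vertex_partition \<P> \<Longrightarrow> P \<in> \<P> \<Longrightarrow> Q \<in> \<P> \<Longrightarrow> P \<noteq> Q \<Longrightarrow> P \<inter> Q = {}"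
  unfolding vertex_partition_def pairwise_def disjnt_def by blast

lemma disjoint_Union_parts:
  assumes "vertex_partition \<P>" and "\<Q> \<subseteq> \<P>" and "P \<in> \<P> - \<Q>"
  shows "P \<inter> \<Union>\<Q> = {}"
  using disjoint_parts[OF assms(1)] assms(2,3) by blast

lemma Union_complement_parts:
  assumes "vertex_partition \<P>" and "\<Q> \<subseteq> \<P>"
  shows "\<Union>(\<P> - \<Q>) = V - \<Union>\<Q>"
proof -
  have "\<Union>\<P> = V" using assms(1) unfolding vertex_partition_def by blast
  then show ?thesis using disjoint_Union_parts[OF assms] assms(2) by blast
qed

lemma vertex_partition_merge:
  assumes "vertex_partition \<P>" and "\<Q> \<subseteq> \<P>"
  shows "vertex_partition (merge \<P> \<Q>)"
proof -
  have "\<Union>(merge \<P> \<Q>) = V" using assms unfolding merge_def vertex_partition_def by blast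
  moreover have "pairwise disjnt (merge \<P> \<Q>)"
  proof -
    have "pairwise disjnt (\<P> - \<Q>)"
      using assms(1) unfolding vertex_partition_def by (auto intro: pairwise_subset)
    then show ?thesis unfolding merge_def pairwise_insert disjnt_def
      using disjoint_Union_parts[OF assms] by blast
  qed
  ultimately show ?thesis unfolding vertex_partition_def by blast
qed

lemma join_vector_merge:
  assumes "join_vector \<P> W z" and "\<Q> \<subseteq> \<P>"
  shows "join_vector (merge \<P> \<Q>) W z"
proof -
  have "1 \<le> sum z (cut (\<Union>\<R>))" if R: "\<R> \<subseteq> merge \<P> \<Q>" "odd (card (\<Union>\<R> \<inter> W))" for \<R>
  proof -
    \<comment> \<open>Expanding the merged part shows that every cut of the contracted graph is
      already a cut of the original one.\<close>
    let ?R = "if \<Union>\<Q> \<in> \<R> then (\<R> - {\<Union>\<Q>}) \<union> \<Q> else \<R>"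
    have "\<Union>?R = \<Union>\<R>" by auto
    moreover have "?R \<subseteq> \<P>" using R(1) assms(2) unfolding merge_def by auto
    ultimately show ?thesis using assms(1) R(2) unfolding join_vector_def by metis
  qed
  then show ?thesis using assms(1) unfolding join_vector_def by blast
qed

lemma card_merge:
  assumes "vertex_partition \<P>" and "\<Q> \<subseteq> \<P>" and "2 \<le> card \<Q>"
  shows "card (merge \<P> \<Q>) < card \<P>"
proof -
  have f: "finite \<P>" using finite_partition[OF assms(1)] .
  then have fQ: "finite \<Q>" by (rule rev_finite_subset[OF _ assms(2)])
  have "card (merge \<P> \<Q>) \<le> Suc (card (\<P> - \<Q>))" unfolding merge_def using f by (simp add: card_insert_if)
  also have "\<dots> = Suc (card \<P> - card \<Q>)" using card_Diff_subset[OF fQ assms(2)] by simp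
  also have "\<dots> < card \<P>" using assms(3) card_mono[OF f assms(2)] by linarith
  finally show ?thesis .
qed

text \<open>Where \<open>z e\<close> is at least 1, using \<open>e\<close> is free. In the graph
  with \<open>P\<close> and \<open>Q\<close> merged \<open>e\<close> is a loop; \<open>e\<close>
  then serves to repair the parity at \<open>P\<close>, and the parity at \<open>Q\<close> follows
  because that of their union is right and \<open>e\<close> does not change it.\<close>

lemma contract_dominates:
  assumes part: "vertex_partition \<P>" and PQ: "P \<in> \<P>" "Q \<in> \<P>" "P \<noteq> Q"
    and e: "e \<in> cut P" "e \<in> cut Q" and "1 \<le> z e"
    and dom: "dominates E incidence (joins (merge \<P> {P, Q}) W) z"
  shows "dominates E incidence (joins \<P> W) z"
proof (rule dominates_trans[OF dom, where a = "\<lambda>f. of_bool (f = e)" and c = "\<lambda>f. of_bool (f \<noteq> e)"])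
  have eE: "e \<in> E" using e cut_subset by blast
  have disj: "P \<inter> Q = {}" using disjoint_parts[OF part PQ] .
  have ends: "ends e \<subseteq> P \<union> Q"
    using e disj unfolding cut_iff by (auto simp: doubleton_eq_iff)
  have "dominates E incidence (joins \<P> W) (\<lambda>f. of_bool (f = e) + of_bool (f \<noteq> e) * incidence J' f)"
    if J': "J' \<in> joins (merge \<P> {P, Q}) W" for J'
  proof -
    have J'E: "J' \<subseteq> E" using joins_subset[OF J'] .
    \<comment> \<open>Whether \<open>J'\<close> contains the loop \<open>e\<close> is irrelevant; it
      is kept or removed as the parity at \<open>P\<close> demands.\<close>
    define J where "J = (if odd (card ((J' - {e}) \<inter> cut P)) \<longleftrightarrow> odd (card (P \<inter> W)) then J' - {e} else insert e J')"
    have JE: "J \<subseteq> E" using J'E eE unfolding J_def by auto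
    have off: "J \<inter> cut R = J' \<inter> cut R" if "e \<notin> cut R" for R using that unfolding J_def by auto
    have parP: "odd (card (J \<inter> cut P)) \<longleftrightarrow> odd (card (P \<inter> W))"
    proof (cases "odd (card ((J' - {e}) \<inter> cut P)) \<longleftrightarrow> odd (card (P \<inter> W))")
      case True then show ?thesis unfolding J_def by simp
    next
      case False
      have "insert e J' \<inter> cut P = insert e ((J' - {e}) \<inter> cut P)" using e by blast
      moreover have "finite ((J' - {e}) \<inter> cut P)" using finite_cut by simp
      ultimately have "card (insert e J' \<inter> cut P) = Suc (card ((J' - {e}) \<inter> cut P))" by simp
      then show ?thesis using False unfolding J_def by auto
    qed
    have "e \<notin> cut (P \<union> Q)" using ends unfolding cut_iff by auto
    then have "J \<inter> cut (P \<union> Q) = J' \<inter> cut (P \<union> Q)" by (rule off)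
    moreover have "P \<union> Q \<in> merge \<P> {P, Q}" unfolding merge_def by simp
    then have "odd (card (J' \<inter> cut (P \<union> Q))) \<longleftrightarrow> odd (card ((P \<union> Q) \<inter> W))"
      by (rule joins_odd[OF J'])
    moreover have "card ((P \<union> Q) \<inter> W) = card (P \<inter> W) + card (Q \<inter> W)"
    proof -
      have "P \<subseteq> V" "Q \<subseteq> V" using part PQ unfolding vertex_partition_def by auto
      then have "finite P" "finite Q" using finite_V finite_subset by auto
      then show ?thesis using disj unfolding Int_Un_distrib2 by (intro card_Un_disjoint) auto
    qed
    ultimately have parQ: "odd (card (J \<inter> cut Q)) \<longleftrightarrow> odd (card (Q \<inter> W))"
      using parP odd_card_cut_Un[OF JE disj] by auto
    have "odd (card (J \<inter> cut R)) \<longleftrightarrow> odd (card (R \<inter> W))" if R: "R \<in> \<P>" "R \<noteq> P" "R \<noteq> Q" for R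
    proof -
      have "R \<inter> (P \<union> Q) = {}" using disjoint_parts[OF part] R PQ by blast
      then have "e \<notin> cut R" using ends unfolding cut_iff by auto
      then have "J \<inter> cut R = J' \<inter> cut R" by (rule off)
      moreover have "R \<in> merge \<P> {P, Q}" unfolding merge_def using R by simp
      ultimately show ?thesis using joins_odd[OF J'] by simp
    qed
    then have "J \<in> joins \<P> W" using JE parP parQ by (intro joinsI) auto
    then show ?thesis by (rule dominates.base) (simp add: J_def)
  qed
  then show "\<forall>J'\<in>joins (merge \<P> {P, Q}) W.
    dominates E incidence (joins \<P> W) (\<lambda>f. of_bool (f = e) + of_bool (f \<noteq> e) * incidence J' f)" by blast
qed (use assms in auto)

text \<open>\<open>J2\<close> decides the edges inside \<open>\<Union>\<Q>\<close> and
  \<open>J1\<close> all others. On the cut the two agree, so every part sees one of the two joins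
  unchanged.\<close>

lemma glue_joins:
  assumes part: "vertex_partition \<P>" and Q: "\<Q> \<subseteq> \<P>"
    and J1: "J1 \<in> joins (merge \<P> \<Q>) W" and J2: "J2 \<in> joins (merge \<P> (\<P> - \<Q>)) W"
    and agree: "J1 \<inter> cut (\<Union>\<Q>) = J2 \<inter> cut (\<Union>\<Q>)"
  shows "{e\<in>J1. \<not> ends e \<subseteq> \<Union>\<Q>} \<union> {e\<in>J2. ends e \<subseteq> \<Union>\<Q>} \<in> joins \<P> W" (is "?J \<in> _")
proof -
  have "?J \<subseteq> E" using joins_subset[OF J1] joins_subset[OF J2] by blast
  moreover have "odd (card (?J \<inter> cut P)) \<longleftrightarrow> odd (card (P \<inter> W))" if P: "P \<in> \<P>" for P
  proof (cases "P \<in> \<Q>")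
    case True
    have "e \<in> ?J \<longleftrightarrow> e \<in> J2" if e: "e \<in> cut P" for e
    proof (cases "ends e \<subseteq> \<Union>\<Q>")
      case False
      obtain u v where uv: "e \<in> E" "ends e = {u, v}" "u \<in> P" using e unfolding cut_iff by blast
      then have "u \<in> \<Union>\<Q>" using True by blast
      moreover have "v \<notin> \<Union>\<Q>" using False uv(2) calculation by auto
      ultimately have "e \<in> cut (\<Union>\<Q>)" using uv(1,2) unfolding cut_iff by blast
      then show ?thesis using agree False by blast
    qed simp
    then have "?J \<inter> cut P = J2 \<inter> cut P" by blast
    moreover have "P \<in> merge \<P> (\<P> - \<Q>)" using True P unfolding merge_def by simp
    ultimately show ?thesis using joins_odd[OF J2] by simp
  next
    case False
    then have "P \<inter> \<Union>\<Q> = {}" using disjoint_Union_parts[OF part Q] P by blast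
    then have "\<not> ends e \<subseteq> \<Union>\<Q>" if "e \<in> cut P" for e using that unfolding cut_iff by auto
    then have "?J \<inter> cut P = J1 \<inter> cut P" by blast
    moreover have "P \<in> merge \<P> \<Q>" using False P unfolding merge_def by simp
    ultimately show ?thesis using joins_odd[OF J1] by simp
  qed
  ultimately show ?thesis by (rule joinsI)
qed

text \<open>Every member meets \<open>D\<close> oddly, hence at least once, while the average is 1;
  so each member in use meets \<open>D\<close> in a single edge. This edge is distributed exactly
  according to \<open>z\<close>, and it is the label for the coupling.\<close>

lemma tight_combination:
  assumes dom: "dominates E incidence X z" and D: "D \<subseteq> E" "sum z D = 1"
    and ge: "\<forall>J\<in>X. odd (card (J \<inter> D))"
  shows "\<exists>T l. finite T \<and> T \<subseteq> X \<and> (\<forall>J\<in>T. l J \<ge> 0) \<and> sum l T = (1::real) \<and>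
    (\<forall>e\<in>E. (\<Sum>J\<in>T. l J * incidence J e) \<le> z e) \<and> (\<forall>J\<in>T. \<exists>e\<in>D. J \<inter> D = {e}) \<and>
    (\<forall>e\<in>D. sum l {J\<in>T. J \<inter> D = {e}} = z e)"
proof -
  have fD: "finite D" using finite_subset[OF D(1) finite_E] .
  have sI: "(\<Sum>e\<in>D. incidence J e) = card (J \<inter> D)" for J using sum_incidence[OF fD] .
  have "\<forall>D'\<in>{D}. \<forall>J\<in>X. 1 \<le> (\<Sum>e\<in>D'. incidence J e)"
  proof (intro ballI)
    fix D' J assume "D' \<in> {D}" "J \<in> X"
    then have "D' = D" and "odd (card (J \<inter> D))" using ge by auto
    then have "card (J \<inter> D) \<ge> 1" using odd_pos by fastforce
    then show "1 \<le> (\<Sum>e\<in>D'. incidence J e)" unfolding \<open>D' = D\<close> sI by linarith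
  qed
  then have "dominates E incidence {J\<in>X. \<forall>D'\<in>{D}. (\<Sum>e\<in>D'. incidence J e) = 1} z"
    by (rule dominates_restrict_tight[OF dom, rotated]) (use fD D in auto)
  from dominates_combination[OF this] obtain T and l :: "'e set \<Rightarrow> real" where T: "finite T"
    "T \<subseteq> {J\<in>X. \<forall>D'\<in>{D}. (\<Sum>e\<in>D'. incidence J e) = 1}" "\<forall>J\<in>T. l J \<ge> 0" "sum l T = 1"
    "\<forall>e\<in>E. (\<Sum>J\<in>T. l J * incidence J e) \<le> z e" by (elim exE conjE)
  have c1: "card (J \<inter> D) = 1" if "J \<in> T" for J using T(2) that sI[of J] by auto
  have single: "\<exists>e\<in>D. J \<inter> D = {e}" if "J \<in> T" for J
    using c1[OF that] by (metis card_1_singletonE Int_iff singletonI)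
  have "(\<Sum>e\<in>D. \<Sum>J\<in>T. l J * incidence J e) = (\<Sum>J\<in>T. l J * (\<Sum>e\<in>D. incidence J e))"
    unfolding sum_distrib_left by (rule sum.swap)
  also have "\<dots> = sum z D" unfolding sI using c1 T(4) D(2) by simp
  \<comment> \<open>Both sides of the domination have total 1 on \<open>D\<close>, so the
    nonnegative slacks all vanish.\<close>
  finally have eq: "(\<Sum>e\<in>D. z e - (\<Sum>J\<in>T. l J * incidence J e)) = 0" by (simp add: sum_subtractf)
  have "\<forall>e\<in>D. z e - (\<Sum>J\<in>T. l J * incidence J e) = 0"
    using eq T(5) D(1) fD by (subst (asm) sum_nonneg_eq_0_iff) auto
  moreover have "(\<Sum>J\<in>T. l J * incidence J e) = sum l {J\<in>T. J \<inter> D = {e}}" if "e \<in> D" for e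
  proof -
    have "e \<in> J \<longleftrightarrow> J \<inter> D = {e}" if "J \<in> T" for J 
    proof -
      obtain e' where "J \<inter> D = {e'}" using single[OF \<open>J \<in> T\<close>] by blast
      then show ?thesis using \<open>e \<in> D\<close> by auto
    qed
    then have "(\<Sum>J\<in>T. l J * incidence J e) = (\<Sum>J\<in>T. if J \<inter> D = {e} then l J else 0)"
      by (intro sum.cong) auto
    also have "\<dots> = sum l (T \<inter> {J. J \<inter> D = {e}})" using T(1) by (simp add: sum.inter_restrict)
    finally show ?thesis by (simp add: Int_def)
  qed
  ultimately have "\<forall>e\<in>D. sum l {J\<in>T. J \<inter> D = {e}} = z e" by simp
  then show ?thesis using T single by (intro exI[of _ T] exI[of _ l]) auto
qed

text \<open>Either side of the tight cut is contracted. In both combinations the single edge used in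
  the cut has the same distribution, so they can be coupled along that edge and glued pair by
  pair.\<close>

lemma glue_dominates:
  assumes part: "vertex_partition \<P>" and Q: "\<Q> \<subseteq> \<P>"
    and odd: "odd (card (\<Union>\<Q> \<inter> W))" "odd (card ((V - \<Union>\<Q>) \<inter> W))" and tight: "sum z (cut (\<Union>\<Q>)) = 1"
    and dom1: "dominates E incidence (joins (merge \<P> \<Q>) W) z"
    and dom2: "dominates E incidence (joins (merge \<P> (\<P> - \<Q>)) W) z"
  shows "dominates E incidence (joins \<P> W) z"
proof -
  let ?D = "cut (\<Union>\<Q>)"
  have "\<forall>J\<in>joins (merge \<P> \<Q>) W. odd (card (J \<inter> ?D))"
  proof
    fix J assume J: "J \<in> joins (merge \<P> \<Q>) W"
    have "\<Union>\<Q> \<in> merge \<P> \<Q>" unfolding merge_def by simp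
    then show "odd (card (J \<inter> ?D))" using joins_odd[OF J] odd by simp
  qed
  from tight_combination[OF dom1 cut_subset tight this]
  obtain T1 and l1 :: "'e set \<Rightarrow> real" where T1: "finite T1" "T1 \<subseteq> joins (merge \<P> \<Q>) W"
    "\<forall>J\<in>T1. l1 J \<ge> 0" "sum l1 T1 = 1" "\<forall>e\<in>E. (\<Sum>J\<in>T1. l1 J * incidence J e) \<le> z e"
    "\<forall>J\<in>T1. \<exists>e\<in>?D. J \<inter> ?D = {e}" "\<forall>e\<in>?D. sum l1 {J\<in>T1. J \<inter> ?D = {e}} = z e"
    by (elim exE conjE)
  have "\<forall>J\<in>joins (merge \<P> (\<P> - \<Q>)) W. odd (card (J \<inter> ?D))"
  proof
    fix J assume J: "J \<in> joins (merge \<P> (\<P> - \<Q>)) W"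
    have "V - \<Union>\<Q> \<in> merge \<P> (\<P> - \<Q>)"
      unfolding merge_def Union_complement_parts[OF part Q] by simp
    then have "odd (card (J \<inter> cut (V - \<Union>\<Q>)))" using joins_odd[OF J] odd by simp
    then show "odd (card (J \<inter> ?D))" unfolding cut_complement .
  qed
  from tight_combination[OF dom2 cut_subset tight this]
  obtain T2 and l2 :: "'e set \<Rightarrow> real" where T2: "finite T2" "T2 \<subseteq> joins (merge \<P> (\<P> - \<Q>)) W"
    "\<forall>J\<in>T2. l2 J \<ge> 0" "sum l2 T2 = 1" "\<forall>e\<in>E. (\<Sum>J\<in>T2. l2 J * incidence J e) \<le> z e"
    "\<forall>J\<in>T2. \<exists>e\<in>?D. J \<inter> ?D = {e}" "\<forall>e\<in>?D. sum l2 {J\<in>T2. J \<inter> ?D = {e}} = z e"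
    by (elim exE conjE)
  let ?g = "\<lambda>J. J \<inter> ?D"
  \<comment> \<open>The labels are the traces on the cut, all of them singletons; the label
    \<open>{e}\<close> has mass \<open>z e\<close> on both sides.\<close>
  let ?C = "(\<lambda>e. {e}) ` ?D"
  define I where "I = (SIGMA a:T1. {b\<in>T2. ?g a = ?g b})"
  have "\<exists>w. (\<forall>i\<in>I. w i \<ge> 0) \<and> (\<forall>h. (\<Sum>i\<in>I. w i * h (fst i)) = (\<Sum>a\<in>T1. l1 a * h a)) \<and>
    (\<forall>h. (\<Sum>i\<in>I. w i * h (snd i)) = (\<Sum>b\<in>T2. l2 b * h b))"
    unfolding I_def
    by (rule coupling[where D = ?C and m = "\<lambda>c. z (the_elem c)"]) (use T1 T2 in auto)
  then obtain w where w: "\<forall>i\<in>I. w i \<ge> 0"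
    and w1: "\<forall>h. (\<Sum>i\<in>I. w i * h (fst i)) = (\<Sum>a\<in>T1. l1 a * h a)"
    and w2: "\<forall>h. (\<Sum>i\<in>I. w i * h (snd i)) = (\<Sum>b\<in>T2. l2 b * h b)" by (elim exE conjE)
  have fI: "finite I" unfolding I_def using T1(1) T2(1) by simp
  have sw: "sum w I = 1" using w1[THEN spec, of "\<lambda>_. 1"] T1(4) by simp
  define glue where "glue i = {e\<in>fst i. \<not> ends e \<subseteq> \<Union>\<Q>} \<union> {e\<in>snd i. ends e \<subseteq> \<Union>\<Q>}" for i :: "'e set \<times> 'e set"
  have "dominates E incidence (joins \<P> W) (incidence (glue i))" if "i \<in> I" for i
  proof -
    have "fst i \<in> joins (merge \<P> \<Q>) W" "snd i \<in> joins (merge \<P> (\<P> - \<Q>)) W" "?g (fst i) = ?g (snd i)"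
      using that T1(2) T2(2) unfolding I_def by auto
    then have "glue i \<in> joins \<P> W" unfolding glue_def by (rule glue_joins[OF part Q])
    then show ?thesis by (rule dominates.base) simp
  qed
  then have "dominates E incidence (joins \<P> W) (\<lambda>e. (\<Sum>i\<in>I. w i * incidence (glue i) e) / sum w I)"
    using fI w sw by (intro dominates_sum) auto
  then show ?thesis
  proof (rule dominates_weaken, intro ballI)
    fix e assume e: "e \<in> E"
    show "(\<Sum>i\<in>I. w i * incidence (glue i) e) / sum w I \<le> z e"
    proof (cases "ends e \<subseteq> \<Union>\<Q>")
      case True
      then have "(\<Sum>i\<in>I. w i * incidence (glue i) e) = (\<Sum>i\<in>I. w i * incidence (snd i) e)"
        unfolding glue_def by (intro sum.cong) auto
      also have "\<dots> = (\<Sum>b\<in>T2. l2 b * incidence b e)" by (rule w2[THEN spec])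
      finally show ?thesis using T2(5) e sw by simp
    next
      case False
      then have "(\<Sum>i\<in>I. w i * incidence (glue i) e) = (\<Sum>i\<in>I. w i * incidence (fst i) e)"
        unfolding glue_def by (intro sum.cong) auto
      also have "\<dots> = (\<Sum>a\<in>T1. l1 a * incidence a e)" by (rule w1[THEN spec])
      finally show ?thesis using T1(5) e sw by simp
    qed
  qed
qed

section \<open>Degree counts and directions for join vectors\<close>

lemma cut_Union_part: "e \<in> cut (\<Union>\<Q>) \<Longrightarrow> \<exists>P\<in>\<Q>. e \<in> cut P"
  unfolding cut_iff by blast

lemma cut_other_part:
  assumes part: "vertex_partition \<P>" and P: "P \<in> \<P>" and e: "e \<in> cut P"
  shows "\<exists>Q\<in>\<P>. Q \<noteq> P \<and> e \<in> cut Q"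
proof -
  obtain u v where uv: "e \<in> E" "ends e = {u, v}" "u \<in> P" "v \<notin> P" using e unfolding cut_iff by blast
  have "v \<in> \<Union>\<P>" using ends_subset[OF uv(1)] uv(2) part unfolding vertex_partition_def by simp
  then obtain Q where Q: "Q \<in> \<P>" "v \<in> Q" by blast
  have "Q \<noteq> P" using Q uv(4) by blast
  then have "u \<notin> Q" using disjoint_parts[OF part Q(1) P] uv(3) by blast
  moreover have "ends e = {v, u}" using uv(2) by auto
  ultimately have "e \<in> cut Q" using uv(1) Q(2) unfolding cut_iff by blast
  then show ?thesis using Q \<open>Q \<noteq> P\<close> by blast
qed

lemma card_cut_parts:
  assumes part: "vertex_partition \<P>" and e: "e \<in> E"
  shows "card {P\<in>\<P>. e \<in> cut P} \<le> 2"
proof -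
  define pt where "pt v = (THE P. P \<in> \<P> \<and> v \<in> P)" for v
  have "{P\<in>\<P>. e \<in> cut P} \<subseteq> pt ` ends e"
  proof
    fix P assume P: "P \<in> {P\<in>\<P>. e \<in> cut P}"
    then obtain u where u: "u \<in> ends e" "u \<in> P" unfolding cut_iff by blast
    have "pt u = P" unfolding pt_def
    proof (rule the_equality)
      show "P \<in> \<P> \<and> u \<in> P" using P u by simp
      show "Q = P" if "Q \<in> \<P> \<and> u \<in> Q" for Q
        using disjoint_parts[OF part, of Q P] that P u by blast
    qed
    then show "P \<in> pt ` ends e" using u by blast
  qed
  then have "card {P\<in>\<P>. e \<in> cut P} \<le> card (pt ` ends e)"
    using finite_ends[OF e] by (intro card_mono) auto
  also have "\<dots> \<le> card (ends e)" using finite_ends[OF e] by (rule card_image_le)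
  finally show ?thesis using card_ends[OF e] by simp
qed

lemma sum_degrees_le:
  assumes part: "vertex_partition \<P>" and "A \<subseteq> \<P>" and F: "F \<subseteq> E"
  shows "(\<Sum>P\<in>A. card (F \<inter> cut P)) = (\<Sum>e\<in>F. card {P\<in>A. e \<in> cut P})"
    and "\<forall>e\<in>F. card {P\<in>A. e \<in> cut P} \<le> 2"
proof -
  have fA: "finite A" using finite_partition[OF part] assms(2) by (rule rev_finite_subset)
  have fF: "finite F" using finite_E F by (rule rev_finite_subset)
  have "(\<Sum>P\<in>A. card (F \<inter> cut P)) = (\<Sum>P\<in>A. \<Sum>e\<in>{e\<in>F. e \<in> cut P}. 1)" by (simp add: Int_def)
  also have "\<dots> = (\<Sum>e\<in>F. \<Sum>P\<in>{P\<in>A. e \<in> cut P}. 1)" by (rule sum.swap_restrict[OF fA fF])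
  finally show "(\<Sum>P\<in>A. card (F \<inter> cut P)) = (\<Sum>e\<in>F. card {P\<in>A. e \<in> cut P})" by simp
  show "\<forall>e\<in>F. card {P\<in>A. e \<in> cut P} \<le> 2"
  proof
    fix e assume e: "e \<in> F"
    have "card {P\<in>A. e \<in> cut P} \<le> card {P\<in>\<P>. e \<in> cut P}"
      using finite_partition[OF part] assms(2) by (intro card_mono) auto
    then show "card {P\<in>A. e \<in> cut P} \<le> 2" using card_cut_parts[OF part] e F by fastforce
  qed
qed

text \<open>The support \<open>F\<close> is 2-regular on the parts it touches. Doubling
  \<open>y\<close> there is feasible and has an edge of value 1, so \<open>con\<close> applies and
  yields a join \<open>J\<close> inside \<open>F\<close>. As all degrees of \<open>F\<close> are
  even, \<open>F - J\<close> is a join too, and the average of the two is \<open>1/2\<close> on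
  \<open>F\<close>.\<close>

lemma half_integral_dominates:
  assumes part: "vertex_partition \<P>" and y: "join_vector \<P> W y"
    and con: "\<forall>P\<in>\<P>. \<forall>Q\<in>\<P>. \<forall>e z. P \<noteq> Q \<longrightarrow> e \<in> cut P \<longrightarrow> e \<in> cut Q \<longrightarrow> join_vector \<P> W z \<longrightarrow> 1 \<le> z e \<longrightarrow>
      dominates E incidence (joins \<P> W) z"
    and F: "F \<subseteq> E" "\<forall>e\<in>F. \<exists>P\<in>\<P>. e \<in> cut P" and half: "\<forall>e\<in>F. y e = 1/2"
    and off: "\<forall>P\<in>\<P>. \<forall>e\<in>cut P. e \<notin> F \<longrightarrow> y e = 0"
    and deg: "\<forall>P\<in>A. odd (card (P \<inter> W)) \<and> card (F \<inter> cut P) = 2"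
    and A: "A \<subseteq> \<P>" "\<forall>P\<in>\<P>. \<forall>e\<in>F. e \<in> cut P \<longrightarrow> P \<in> A"
  shows "dominates E incidence (joins \<P> W) y"
proof (cases "F = {}")
  case True
  have "odd (card ({} \<inter> cut P)) \<longleftrightarrow> odd (card (P \<inter> W))" if P: "P \<in> \<P>" for P
  proof -
    \<comment> \<open>Without fractional edges all stars have value 0, so no part is odd and the
      empty join works.\<close>
    have "sum y (cut P) = 0" using off P True by (intro sum.neutral) blast
    moreover have "odd (card (\<Union>{P} \<inter> W)) \<longrightarrow> 1 \<le> sum y (cut (\<Union>{P}))"
      using y P unfolding join_vector_def by blast
    ultimately show ?thesis by auto
  qed
  then have "{} \<in> joins \<P> W" by (intro joinsI) auto
  then show ?thesis using y unfolding join_vector_def by (intro dominates.base[of "{}"]) auto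
next
  case False
  have fF: "finite F" using finite_E F(1) by (rule rev_finite_subset)
  have z: "join_vector \<P> W (incidence F)"
    unfolding join_vector_def
  proof (intro conjI allI impI)
    show "\<forall>e\<in>E. 0 \<le> incidence F e \<and> incidence F e \<le> 1" by simp
    fix \<Q> assume Q: "\<Q> \<subseteq> \<P>" "odd (card (\<Union>\<Q> \<inter> W))"
    have "1 \<le> sum y (cut (\<Union>\<Q>))" using y Q unfolding join_vector_def by blast
    moreover have "sum y (cut (\<Union>\<Q>)) \<le> (\<Sum>e\<in>cut (\<Union>\<Q>). incidence F e)"
    proof (rule sum_mono)
      fix e assume e: "e \<in> cut (\<Union>\<Q>)"
      then obtain P where "P \<in> \<Q>" "e \<in> cut P" using cut_Union_part by blast
      then show "y e \<le> incidence F e" using off half Q(1) by (cases "e \<in> F") auto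
    qed
    ultimately show "1 \<le> (\<Sum>e\<in>cut (\<Union>\<Q>). incidence F e)" by linarith
  qed
  obtain e where e: "e \<in> F" using False by blast
  then obtain P where P: "P \<in> \<P>" "e \<in> cut P" using F(2) by blast
  obtain Q where Q: "Q \<in> \<P>" "Q \<noteq> P" "e \<in> cut Q" using cut_other_part[OF part P] by blast
  have "dominates E incidence (joins \<P> W) (incidence F)"
    using con[rule_format, of P Q e "incidence F"] P Q z e by simp
  from dominates_support[OF this] obtain J where J: "J \<in> joins \<P> W"
    and JF: "\<forall>e\<in>E. incidence F e \<le> 0 \<longrightarrow> incidence J e = 0" by auto
  have sub: "J \<subseteq> F"
  proof
    fix f assume f: "f \<in> J"
    then have "f \<in> E" using joins_subset[OF J] by blast
    then show "f \<in> F" using JF f by (cases "f \<in> F") auto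
  qed
  have "F - J \<in> joins \<P> W"
  proof (rule joinsI)
    show "F - J \<subseteq> E" using F(1) by blast
    fix P assume P: "P \<in> \<P>"
    have "(F - J) \<inter> cut P = F \<inter> cut P - J \<inter> cut P" by blast
    moreover have "card (F \<inter> cut P - J \<inter> cut P) = card (F \<inter> cut P) - card (J \<inter> cut P)"
      using sub finite_cut by (intro card_Diff_subset) auto
    ultimately have c: "card ((F - J) \<inter> cut P) = card (F \<inter> cut P) - card (J \<inter> cut P)" by simp
    have le: "card (J \<inter> cut P) \<le> card (F \<inter> cut P)" using sub finite_cut by (intro card_mono) auto
    have "even (card (F \<inter> cut P))"
    proof (cases "P \<in> A")
      case True
      then show ?thesis using deg by simp
    next
      case False
      then have "F \<inter> cut P = {}" using A(2) P by blast
      then show ?thesis by simp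
    qed
    then show "odd (card ((F - J) \<inter> cut P)) \<longleftrightarrow> odd (card (P \<inter> W))"
      using joins_odd[OF J P] le unfolding c by simp
  qed
  then have d2: "dominates E incidence (joins \<P> W) (incidence (F - J))" by (rule dominates.base) simp
  have d1: "dominates E incidence (joins \<P> W) (incidence J)" using J by (rule dominates.base) simp
  show ?thesis
  proof (rule dominates_convex[OF d1 d2, of "1/2"])
    show "\<forall>e\<in>E. 1/2 * incidence J e + (1 - 1/2) * incidence (F - J) e \<le> y e"
    proof
      fix e assume e: "e \<in> E"
      have "0 \<le> y e" using y e unfolding join_vector_def by blast
      then show "1/2 * incidence J e + (1 - 1/2) * incidence (F - J) e \<le> y e"
        using half sub by (cases "e \<in> F") auto
    qed
  qed simp_all
qed

text \<open>Each tight star contains at least two fractional edges and each edge lies in at most two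
  stars, so there are at most as many equations as unknowns. Equality forces the fractional edges to
  form a 2-regular graph on the tight parts, which either is half-integral or has the direction
  \<open>y - 1/2\<close>.\<close>

lemma join_direction:
  assumes part: "vertex_partition \<P>" and y: "join_vector \<P> W y"
    and con: "\<forall>P\<in>\<P>. \<forall>Q\<in>\<P>. \<forall>e z. P \<noteq> Q \<longrightarrow> e \<in> cut P \<longrightarrow> e \<in> cut Q \<longrightarrow> join_vector \<P> W z \<longrightarrow> 1 \<le> z e \<longrightarrow>
      dominates E incidence (joins \<P> W) z"
    and lt1: "\<forall>P\<in>\<P>. \<forall>e\<in>cut P. y e < 1"
  shows "dominates E incidence (joins \<P> W) y \<or> (\<exists>d. (\<exists>e\<in>E. d e \<noteq> 0) \<and>
    (\<forall>e. y e = 0 \<or> y e = 1 \<longrightarrow> d e = (0::real)) \<and>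
    (\<forall>P\<in>\<P>. odd (card (P \<inter> W)) \<longrightarrow> sum y (cut P) = 1 \<longrightarrow> sum d (cut P) = 0))"
    (is "?dom \<or> (\<exists>d. ?dir d)")
proof -
  define F where "F = {e\<in>E. y e \<noteq> 0 \<and> y e \<noteq> 1}"
  define A where "A = {P\<in>\<P>. odd (card (P \<inter> W)) \<and> sum y (cut P) = 1}"
  have FE: "F \<subseteq> E" and AP: "A \<subseteq> \<P>" unfolding F_def A_def by auto
  have fF: "finite F" using finite_E FE by (rule rev_finite_subset)
  have fA: "finite A" using finite_partition[OF part] AP by (rule rev_finite_subset)
  have y01: "0 \<le> y e" "y e \<le> 1" if "e \<in> E" for e using y that unfolding join_vector_def by auto
  have off: "\<forall>P\<in>\<P>. \<forall>e\<in>cut P. e \<notin> F \<longrightarrow> y e = 0"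
  proof (intro ballI impI)
    fix P e assume "P \<in> \<P>" "e \<in> cut P" "e \<notin> F"
    moreover from this have "y e < 1" using lt1 by blast
    ultimately show "y e = 0" using cut_subset[of P] unfolding F_def by auto
  qed
  have dirI: "?dir d" if "\<exists>e\<in>F. d e \<noteq> 0" "\<forall>e. e \<notin> F \<longrightarrow> d e = 0" "\<forall>P\<in>A. sum d (cut P) = 0"
    "\<forall>e. y e = 0 \<or> y e = 1 \<longrightarrow> d e = 0" for d
    using that unfolding F_def A_def by auto
  have yF: "sum y (cut P) = sum y (F \<inter> cut P)" if "P \<in> \<P>" for P
    using off that finite_cut by (intro sum.mono_neutral_right) auto
  show ?thesis
  proof (cases "\<forall>e\<in>F. \<exists>P\<in>\<P>. e \<in> cut P")
    case False
    then obtain e where e: "e \<in> F" "\<forall>P\<in>\<P>. e \<notin> cut P" by blast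
    \<comment> \<open>A fractional edge inside one part is a loop that no star constraint sees, so
      its coordinate can move alone.\<close>
    have "sum (\<lambda>f. of_bool (f = e)) (cut P) = (0::real)" if "P \<in> A" for P
      using e(2) that AP by (intro sum.neutral) auto
    then have "?dir (\<lambda>f. of_bool (f = e))" using e(1) by (intro dirI) (auto simp: F_def)
    then show ?thesis by (intro disjI2 exI[of _ "\<lambda>f. of_bool (f = e)"])
  next
    case nonloop: True
    have deg_ge: "2 \<le> card (F \<inter> cut P)" if P: "P \<in> A" for P
    proof -
      have PP: "P \<in> \<P>" using P AP by blast
      have s: "sum y (F \<inter> cut P) = 1" using yF[OF PP] P unfolding A_def by simp
      then have "F \<inter> cut P \<noteq> {}" by auto
      then have "card (F \<inter> cut P) \<noteq> 0" using fF by simp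
      moreover have "card (F \<inter> cut P) \<noteq> 1"
      proof
        assume "card (F \<inter> cut P) = 1"
        then obtain e where "F \<inter> cut P = {e}" using card_1_singletonE by blast
        then have "y e = 1" "e \<in> cut P" using s by auto
        moreover have "y e < 1" using lt1 PP \<open>e \<in> cut P\<close> by blast
        ultimately show False by simp
      qed
      ultimately show ?thesis by linarith
    qed
    have dc: "(\<Sum>P\<in>A. card (F \<inter> cut P)) = (\<Sum>e\<in>F. card {P\<in>A. e \<in> cut P})"
      and le2: "\<forall>e\<in>F. card {P\<in>A. e \<in> cut P} \<le> 2" using sum_degrees_le[OF part AP FE] by auto
    have lo: "2 * card A \<le> (\<Sum>P\<in>A. card (F \<inter> cut P))"
      using sum_mono[of A "\<lambda>_. 2" "\<lambda>P. card (F \<inter> cut P)"] deg_ge by (simp add: mult.commute)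
    have hi: "(\<Sum>e\<in>F. card {P\<in>A. e \<in> cut P}) \<le> 2 * card F"
      using sum_mono[of F "\<lambda>e. card {P\<in>A. e \<in> cut P}" "\<lambda>_. 2"] le2 by (simp add: mult.commute)
    show ?thesis
    proof (cases "card A < card F")
      case True
      from homogeneous_solution[OF fA fF True, of "\<lambda>P e. of_bool (e \<in> cut P)"]
      obtain d :: "'e \<Rightarrow> real" where d: "\<exists>e\<in>F. d e \<noteq> 0" "\<forall>e. e \<notin> F \<longrightarrow> d e = 0"
        "\<forall>P\<in>A. (\<Sum>e\<in>F. of_bool (e \<in> cut P) * d e) = 0" by (elim exE conjE)
      have "sum d (cut P) = 0" if "P \<in> A" for P
      proof -
        have "sum d (cut P) = sum d (F \<inter> cut P)"
          using d(2) finite_cut by (intro sum.mono_neutral_right) auto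
        also have "\<dots> = (\<Sum>e\<in>F. if e \<in> cut P then d e else 0)" by (rule sum.inter_restrict[OF fF])
        also have "\<dots> = (\<Sum>e\<in>F. of_bool (e \<in> cut P) * d e)" by (intro sum.cong) auto
        finally show ?thesis using d(3) that by simp
      qed
      then have "?dir d" using d by (intro dirI) (auto simp: F_def)
      then show ?thesis by (intro disjI2 exI[of _ d])
    next
      case False
      \<comment> \<open>The chain \<open>2 * card A \<le> ... \<le> 2 * card F\<close> collapses,
        hence every tight part has exactly two fractional edges and every such edge has two tight
        ends.\<close>
      then have eqAF: "(\<Sum>P\<in>A. card (F \<inter> cut P)) = 2 * card A" "(\<Sum>e\<in>F. card {P\<in>A. e \<in> cut P}) = 2 * card F"
        using lo hi dc by linarith+
      have deg: "card (F \<inter> cut P) = 2" if "P \<in> A" for P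
      proof (rule ccontr)
        assume "card (F \<inter> cut P) \<noteq> 2"
        then have "2 < card (F \<inter> cut P)" using deg_ge[OF that] by simp
        then have "(\<Sum>P\<in>A. 2) < (\<Sum>P\<in>A. card (F \<inter> cut P))"
          using fA that deg_ge by (intro sum_strict_mono_ex1) auto
        then show False using eqAF(1) by simp
      qed
      have full: "card {P\<in>A. e \<in> cut P} = 2" if "e \<in> F" for e
      proof (rule ccontr)
        assume "card {P\<in>A. e \<in> cut P} \<noteq> 2"
        then have "card {P\<in>A. e \<in> cut P} < 2" using le2 that by fastforce
        then have "(\<Sum>e\<in>F. card {P\<in>A. e \<in> cut P}) < (\<Sum>e\<in>F. 2)"
          using fF that le2 by (intro sum_strict_mono_ex1) auto
        then show False using eqAF(2) by simp
      qed
      show ?thesis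
      proof (cases "\<forall>e\<in>F. y e = 1/2")
        case True
        have cl: "\<forall>P\<in>\<P>. \<forall>e\<in>F. e \<in> cut P \<longrightarrow> P \<in> A"
        proof (intro ballI impI)
          fix P e assume Pe: "P \<in> \<P>" "e \<in> F" "e \<in> cut P"
          have "card {P\<in>\<P>. e \<in> cut P} \<le> card {P\<in>A. e \<in> cut P}"
            using card_cut_parts[OF part] full Pe FE by auto
          then have "{P\<in>A. e \<in> cut P} = {P\<in>\<P>. e \<in> cut P}"
            using finite_partition[OF part] AP by (intro card_seteq) auto
          then show "P \<in> A" using Pe by blast
        qed
        have "\<forall>P\<in>A. odd (card (P \<inter> W)) \<and> card (F \<inter> cut P) = 2" using deg unfolding A_def by blast
        then have ?dom using half_integral_dominates[OF part y con FE nonloop True off _ AP cl] by blast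
        then show ?thesis ..
      next
        case notall: False
        \<comment> \<open>At a tight part this sums to \<open>1 - 2 * 1/2 = 0\<close>.\<close>
        let ?d = "\<lambda>e. if e \<in> F then y e - 1/2 else 0"
        have "sum ?d (cut P) = 0" if "P \<in> A" for P
        proof -
          have "sum ?d (cut P) = sum ?d (F \<inter> cut P)"
            using finite_cut by (intro sum.mono_neutral_right) auto
          also have "\<dots> = sum y (F \<inter> cut P) - card (F \<inter> cut P) / 2" by (simp add: sum_subtractf)
          also have "\<dots> = 0" using deg[OF that] yF[of P] that AP unfolding A_def by auto
          finally show ?thesis .
        qed
        then have "?dir ?d" using notall by (intro dirI) (auto simp: F_def)
        then show ?thesis by (intro disjI2 exI[of _ ?d])
      qed
    qed
  qed
qed

text \<open>The Edmonds--Johnson description of the dominant of the \<open>W\<close>-join polytope, below the all-ones vector.\<close>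

lemma dominates_joins_partition:
  assumes "vertex_partition \<P>" and "join_vector \<P> W z"
  shows "dominates E incidence (joins \<P> W) z"
  using assms
proof (induction "card \<P>" arbitrary: \<P> z rule: less_induct)
  case less
  note part = less.prems(1)
  have IH: "dominates E incidence (joins (merge \<P> \<Q>) W) z'"
    if "\<Q> \<subseteq> \<P>" "2 \<le> card \<Q>" "join_vector \<P> W z'" for \<Q> z'
    by (rule less.hyps[OF card_merge[OF part that(1,2)] vertex_partition_merge[OF part that(1)]
      join_vector_merge[OF that(3,1)]])
  have con: "\<forall>P\<in>\<P>. \<forall>Q\<in>\<P>. \<forall>e z'. P \<noteq> Q \<longrightarrow> e \<in> cut P \<longrightarrow> e \<in> cut Q \<longrightarrow> join_vector \<P> W z' \<longrightarrow> 1 \<le> z' e \<longrightarrow>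
      dominates E incidence (joins \<P> W) z'"
  proof (intro ballI allI impI)
    fix P Q e z' assume a: "P \<in> \<P>" "Q \<in> \<P>" "P \<noteq> Q" "e \<in> cut P" "e \<in> cut Q" "join_vector \<P> W z'" "1 \<le> z' e"
    show "dominates E incidence (joins \<P> W) z'"
      by (rule contract_dominates[where e = e and z = z', OF part a(1-3) a(4,5,7)], rule IH) (use a in auto)
  qed
  have UV: "\<Union>\<P> = V" using part unfolding vertex_partition_def by blast
  \<comment> \<open>Otherwise the empty cut of \<open>V\<close> would need value at least 1. Hence a
    cut and its complement are odd together.\<close>
  have "\<not> odd (card (\<Union>\<P> \<inter> W))"
  proof
    assume "odd (card (\<Union>\<P> \<inter> W))"
    then have "1 \<le> sum z (cut (\<Union>\<P>))" using less.prems(2) unfolding join_vector_def by blast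
    then show False using cut_V UV by simp
  qed
  then have evenV: "even (card (V \<inter> W))" using UV by simp
  have compl: "odd (card ((V - U) \<inter> W)) \<longleftrightarrow> odd (card (U \<inter> W))" if "U \<subseteq> V" for U
  proof -
    have "card (V \<inter> W) = card ((V - U) \<inter> W \<union> U \<inter> W)" using that by (intro arg_cong[where f = card]) blast
    also have "\<dots> = card ((V - U) \<inter> W) + card (U \<inter> W)"
      using that finite_V finite_subset[OF that finite_V] by (intro card_Un_disjoint) auto
    finally have "card (V \<inter> W) = card ((V - U) \<inter> W) + card (U \<inter> W)" .
    then show ?thesis using evenV by auto
  qed
  define I where "I = (\<lambda>e. (1::real, {e}, 0::real)) ` E \<union> (\<lambda>e. (-1, {e}, -1)) ` E
    \<union> (\<lambda>\<Q>. (1, cut (\<Union>\<Q>), 1)) ` {\<Q>. \<Q> \<subseteq> \<P> \<and> odd (card (\<Union>\<Q> \<inter> W))}"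
  have fI: "finite I" unfolding I_def using finite_E finite_partition[OF part] by simp
  have feas: "(\<forall>i\<in>I. satisfies y i) \<longleftrightarrow> join_vector \<P> W y" for y :: "'e \<Rightarrow> real"
    unfolding I_def satisfies_def join_vector_def by (auto simp: ball_Un)
  show ?case
  proof (rule polytope_dominates[OF fI])
    show "\<forall>e\<in>E. (1, {e}, 0) \<in> I \<and> (-1, {e}, -1) \<in> I" unfolding I_def by blast
    show "\<forall>i\<in>I. satisfies z i" unfolding feas by (rule less.prems(2))
    show "\<forall>y. (\<forall>i\<in>I. satisfies y i) \<longrightarrow> dominates E incidence (joins \<P> W) y \<or>
      (\<exists>d :: 'e \<Rightarrow> real. (\<exists>e\<in>E. d e \<noteq> 0) \<and> (\<forall>(s, B, b)\<in>I. tight y (s, B, b) \<longrightarrow> sum d B = 0))"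
    proof (intro allI impI)
      fix y :: "'e \<Rightarrow> real" assume "\<forall>i\<in>I. satisfies y i"
      then have y: "join_vector \<P> W y" unfolding feas .
      let ?dom = "dominates E incidence (joins \<P> W) y"
      show "?dom \<or> (\<exists>d :: 'e \<Rightarrow> real. (\<exists>e\<in>E. d e \<noteq> 0) \<and> (\<forall>(s, B, b)\<in>I. tight y (s, B, b) \<longrightarrow> sum d B = 0))"
      \<comment> \<open>Both contractions along such a tight cut have fewer parts, so the induction
        hypothesis handles them and gluing finishes.\<close>
      proof (cases "\<exists>\<Q>. \<Q> \<subseteq> \<P> \<and> 2 \<le> card \<Q> \<and> 2 \<le> card (\<P> - \<Q>) \<and> odd (card (\<Union>\<Q> \<inter> W)) \<and> sum y (cut (\<Union>\<Q>)) = 1")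
        case True
        then obtain \<Q> where Q: "\<Q> \<subseteq> \<P>" "2 \<le> card \<Q>" "2 \<le> card (\<P> - \<Q>)" "odd (card (\<Union>\<Q> \<inter> W))"
          "sum y (cut (\<Union>\<Q>)) = 1" by (elim exE conjE)
        have "\<Union>\<Q> \<subseteq> V" using Q(1) UV by blast
        then have o: "odd (card ((V - \<Union>\<Q>) \<inter> W))" using compl Q(4) by simp
        have ?dom using glue_dominates[OF part Q(1,4) o Q(5) IH[OF Q(1,2) y] IH[OF _ Q(3) y]] by simp
        then show ?thesis ..
      next
        case notight: False
        show ?thesis
        proof (cases "\<exists>P\<in>\<P>. \<exists>e\<in>cut P. 1 \<le> y e")
          case True
          then obtain P e where P: "P \<in> \<P>" "e \<in> cut P" "1 \<le> y e" by (elim bexE)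
          obtain Q where "Q \<in> \<P>" "Q \<noteq> P" "e \<in> cut Q" using cut_other_part[OF part P(1,2)] by blast
          then have ?dom using con[rule_format, of P Q e y] P y by simp
          then show ?thesis ..
        next
          case False
          then have lt1: "\<forall>P\<in>\<P>. \<forall>e\<in>cut P. y e < 1" by (simp add: not_le)
          from join_direction[OF part y con lt1] show ?thesis
          proof
            assume ?dom then show ?thesis ..
          next
            assume "\<exists>d. (\<exists>e\<in>E. d e \<noteq> 0) \<and> (\<forall>e. y e = 0 \<or> y e = 1 \<longrightarrow> d e = (0::real)) \<and>
              (\<forall>P\<in>\<P>. odd (card (P \<inter> W)) \<longrightarrow> sum y (cut P) = 1 \<longrightarrow> sum d (cut P) = 0)"
            then obtain d :: "'e \<Rightarrow> real" where d: "\<exists>e\<in>E. d e \<noteq> 0" "\<forall>e. y e = 0 \<or> y e = 1 \<longrightarrow> d e = 0"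
              "\<forall>P\<in>\<P>. odd (card (P \<inter> W)) \<longrightarrow> sum y (cut P) = 1 \<longrightarrow> sum d (cut P) = 0" by (elim exE conjE)
            \<comment> \<open>What is left of the tight odd cuts are stars: one side consists of a
              single part, since an empty side would be even.\<close>
            have dQ: "sum d (cut (\<Union>\<Q>)) = 0" if Q: "\<Q> \<subseteq> \<P>" "odd (card (\<Union>\<Q> \<inter> W))" "sum y (cut (\<Union>\<Q>)) = 1" for \<Q>
            proof -
              have fQ: "finite \<Q>" "finite (\<P> - \<Q>)" using finite_partition[OF part] finite_subset[OF Q(1)] by auto
              have small: "\<exists>P. \<S> = {P} \<or> \<S> = {}" if "card \<S> < 2" "finite \<S>" for \<S> :: "'v set set"
              proof -
                have "card \<S> = 0 \<or> card \<S> = 1" using that(1) by linarith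
                then show ?thesis using that(2) by (metis card_0_eq card_1_singletonE)
              qed
              have "card \<Q> < 2 \<or> card (\<P> - \<Q>) < 2" using notight Q by (meson not_le)
              then show ?thesis
              proof
                assume "card \<Q> < 2"
                then obtain P where "\<Q> = {P} \<or> \<Q> = {}" using small fQ(1) by blast
                then show ?thesis using Q d(3) by auto
              next
                assume "card (\<P> - \<Q>) < 2"
                then obtain P where "\<P> - \<Q> = {P} \<or> \<P> - \<Q> = {}" using small fQ(2) by blast
                moreover have "\<Union>\<Q> \<subseteq> V" using Q(1) UV by blast
                then have "cut (\<Union>(\<P> - \<Q>)) = cut (\<Union>\<Q>)" "odd (card (\<Union>(\<P> - \<Q>) \<inter> W))"
                  unfolding Union_complement_parts[OF part Q(1)] using cut_complement compl Q(2) by auto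
                ultimately show ?thesis using Q d(3) by auto
              qed
            qed
            have "\<forall>(s, B, b)\<in>I. tight y (s, B, b) \<longrightarrow> sum d B = 0"
              unfolding I_def tight_def using d(2) dQ by (auto simp: ball_Un)
            then show ?thesis using d(1) by blast
          qed
        qed
      qed
    qed
  qed
qed

subsection \<open>Components\<close>

lemma cut_Un_subset: "cut (S \<union> T) \<subseteq> cut S \<union> cut T"
proof
  fix e assume "e \<in> cut (S \<union> T)"
  then obtain u v where "e \<in> E" "ends e = {u, v}" "u \<in> S \<or> u \<in> T" "v \<notin> S" "v \<notin> T"
    unfolding cut_iff by blast
  then show "e \<in> cut S \<union> cut T" unfolding cut_iff Un_iff by blast
qed

lemma cut_Diff_subset: "cut (S - T) \<subseteq> cut S \<union> cut T"
proof
  fix e assume "e \<in> cut (S - T)"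
  then obtain u v where uv: "e \<in> E" "ends e = {u, v}" "u \<in> S" "u \<notin> T" "v \<notin> S \<or> v \<in> T"
    unfolding cut_iff by blast
  moreover have "ends e = {v, u}" using uv(2) by auto
  ultimately show "e \<in> cut S \<union> cut T" unfolding cut_iff Un_iff by blast
qed

text \<open>Connectivity is encoded by vertex sets that no edge of \<open>A\<close> leaves, instead
  of walks, so that everything about components can be read off cuts.\<close>

definition component :: "'e set \<Rightarrow> 'v \<Rightarrow> 'v set" where
  "component A v = \<Inter>{S. S \<subseteq> V \<and> v \<in> S \<and> cut S \<inter> A = {}}"

definition components :: "'e set \<Rightarrow> 'v set set" where
  "components A = component A ` V"

lemma component_subset: "v \<in> V \<Longrightarrow> component A v \<subseteq> V"
  unfolding component_def using cut_V by (intro Inter_lower) auto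

lemma in_component: "v \<in> component A v"
  unfolding component_def by blast

lemma component_least: "S \<subseteq> V \<Longrightarrow> v \<in> S \<Longrightarrow> cut S \<inter> A = {} \<Longrightarrow> component A v \<subseteq> S"
  unfolding component_def by blast

lemma cut_component: "cut (component A v) \<inter> A = {}"
proof (rule ccontr)
  assume "cut (component A v) \<inter> A \<noteq> {}"
  then obtain e where e: "e \<in> cut (component A v)" "e \<in> A" by blast
  then obtain u w where uw: "e \<in> E" "ends e = {u, w}" "u \<in> component A v" "w \<notin> component A v"
    unfolding cut_iff by blast
  then obtain S where S: "S \<subseteq> V" "v \<in> S" "cut S \<inter> A = {}" "w \<notin> S" unfolding component_def by auto
  then have "u \<in> S" using uw(3) component_least by blast
  then have "e \<in> cut S" using uw S(4) unfolding cut_iff by blast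
  then show False using S(3) e(2) by blast
qed

lemma component_eq:
  assumes v: "v \<in> V" and w: "w \<in> component A v"
  shows "component A w = component A v"
proof
  have wV: "w \<in> V" using component_subset[OF v] w by blast
  show sub: "component A w \<subseteq> component A v"
    by (rule component_least[OF component_subset[OF v] w cut_component])
  have "v \<in> component A w"
  proof (rule ccontr)
    assume nv: "v \<notin> component A w"
    let ?S = "component A v - component A w"
    have "cut ?S \<subseteq> cut (component A v) \<union> cut (component A w)" by (rule cut_Diff_subset)
    then have "cut ?S \<inter> A = {}" using cut_component[of A v] cut_component[of A w] by blast
    then have "component A v \<subseteq> ?S"
      using component_subset[OF v] in_component nv by (intro component_least) auto
    then show False using w in_component[of w A] by blast
  qed
  then show "component A v \<subseteq> component A w"
    by (rule component_least[OF component_subset[OF wV] _ cut_component])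
qed

lemma components_disjoint:
  assumes "v \<in> V" and "w \<in> V" and "component A v \<noteq> component A w"
  shows "component A v \<inter> component A w = {}"
proof (rule ccontr)
  assume "component A v \<inter> component A w \<noteq> {}"
  then obtain u where u: "u \<in> component A v" "u \<in> component A w" by blast
  show False using component_eq[OF assms(1) u(1)] component_eq[OF assms(2) u(2)] assms(3) by simp
qed

lemma vertex_partition_components: "vertex_partition (components A)"
proof -
  have "\<Union>(components A) = V"
  proof
    show "\<Union>(components A) \<subseteq> V" unfolding components_def using component_subset by (intro Union_least) auto
    show "V \<subseteq> \<Union>(components A)" unfolding components_def using in_component by blast
  qed
  moreover have "pairwise disjnt (components A)"
    unfolding pairwise_def disjnt_def components_def using components_disjoint by auto
  ultimately show ?thesis unfolding vertex_partition_def by blast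
qed

lemma finite_components: "finite (components A)"
  unfolding components_def using finite_V by simp

lemma component_mono: "A \<subseteq> A' \<Longrightarrow> component A v \<subseteq> component A' v"
  unfolding component_def by (intro Inter_anti_mono) blast

text \<open>The union of the two components is closed because \<open>e\<close> runs inside it, and a
  closed set containing one end of \<open>e\<close> contains both components. All other components
  avoid both ends and stay as they are.\<close>

lemma components_insert:
  assumes e: "e \<in> E" "ends e = {a, b}" and ne: "component A a \<noteq> component A b"
  shows "components (insert e A) = insert (component A a \<union> component A b) (components A - {component A a, component A b})"
    (is "_ = insert ?U (_ - {?a, ?b})")
proof -
  have ab: "a \<in> V" "b \<in> V" using ends_subset[OF e(1)] e(2) by auto
  have cutU: "cut ?U \<inter> insert e A = {}"
  proof -
    have "cut ?U \<subseteq> cut ?a \<union> cut ?b" by (rule cut_Un_subset)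
    then have "cut ?U \<inter> A = {}" using cut_component[of A a] cut_component[of A b] by blast
    moreover have "e \<notin> cut ?U" using e(2) in_component[of a A] in_component[of b A] unfolding cut_iff by auto
    ultimately show ?thesis by blast
  qed
  have merged: "component (insert e A) v = ?U" if v: "v \<in> ?U" for v
  proof
    have vV: "v \<in> V" using v component_subset ab by blast
    show "component (insert e A) v \<subseteq> ?U"
      by (rule component_least[OF _ v cutU]) (use component_subset ab in auto)
    let ?C = "component (insert e A) v"
    have vab: "component A v = ?a \<or> component A v = ?b"
      using v component_eq[OF ab(1), of v A] component_eq[OF ab(2), of v A] by auto
    have sub: "component A v \<subseteq> ?C" by (rule component_mono) blast
    have "a \<in> ?C \<or> b \<in> ?C" using vab sub in_component[of a A] in_component[of b A] by blast
    moreover have "e \<notin> cut ?C" using cut_component[of "insert e A" v] by blast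
    ultimately have both: "a \<in> ?C" "b \<in> ?C" using e unfolding cut_iff by (auto simp: insert_commute)
    have "component (insert e A) a = ?C" "component (insert e A) b = ?C"
      using component_eq[OF vV both(1)] component_eq[OF vV both(2)] by simp_all
    then show "?U \<subseteq> ?C" using component_mono[of A "insert e A" a] component_mono[of A "insert e A" b] by blast
  qed
  have other: "component (insert e A) v = component A v" if v: "v \<in> V" "v \<notin> ?U" for v
  proof
    have "a \<notin> component A v" "b \<notin> component A v"
      using v component_eq[OF v(1), of a A] component_eq[OF v(1), of b A] in_component[of v A] by auto
    then have "e \<notin> cut (component A v)" using e(2) unfolding cut_iff by auto
    then have "cut (component A v) \<inter> insert e A = {}" using cut_component[of A v] by blast
    then show "component (insert e A) v \<subseteq> component A v"
      by (intro component_least component_subset[OF v(1)] in_component)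
    show "component A v \<subseteq> component (insert e A) v" by (rule component_mono) blast
  qed
  have in_U: "v \<in> ?U \<longleftrightarrow> component A v = ?a \<or> component A v = ?b" if "v \<in> V" for v
    using component_eq[OF ab(1), of v A] component_eq[OF ab(2), of v A] in_component[of v A] by blast
  show ?thesis
  proof
    show "components (insert e A) \<subseteq> insert ?U (components A - {?a, ?b})"
    proof
      fix C assume "C \<in> components (insert e A)"
      then obtain v where v: "v \<in> V" "C = component (insert e A) v" unfolding components_def by blast
      show "C \<in> insert ?U (components A - {?a, ?b})"
        using v merged[of v] other[of v] in_U[of v] unfolding components_def by (cases "v \<in> ?U") auto
    qed
    show "insert ?U (components A - {?a, ?b}) \<subseteq> components (insert e A)"
    proof
      fix C assume C: "C \<in> insert ?U (components A - {?a, ?b})"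
      show "C \<in> components (insert e A)"
      proof (cases "C = ?U")
        case True
        then have "C = component (insert e A) a" using merged[of a] in_component[of a A] by blast
        then show ?thesis using ab unfolding components_def by blast
      next
        case False
        then obtain v where v: "v \<in> V" "C = component A v" "C \<noteq> ?a" "C \<noteq> ?b"
          using C unfolding components_def by blast
        then have "C = component (insert e A) v" using other[of v] in_U[of v] by simp
        then show ?thesis using v(1) unfolding components_def by blast
      qed
    qed
  qed
qed

lemma card_components_insert:
  assumes e: "e \<in> E" "ends e = {a, b}"
  shows "card (components A) = card (components (insert e A)) + of_bool (component A a \<noteq> component A b)"
proof (cases "component A a = component A b")
  case True
  have "cut S \<inter> insert e A = {} \<longleftrightarrow> cut S \<inter> A = {}" if S: "S \<subseteq> V" for S
  proof
    assume A: "cut S \<inter> A = {}"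
    have ab: "a \<in> V" "b \<in> V" using ends_subset[OF e(1)] e(2) by auto
    have "a \<in> S \<Longrightarrow> b \<in> S" using component_least[OF S _ A] True in_component[of b A] by blast
    moreover have "b \<in> S \<Longrightarrow> a \<in> S" using component_least[OF S _ A] True in_component[of a A] by blast
    ultimately have "e \<notin> cut S" using e(2) unfolding cut_iff by (auto simp: doubleton_eq_iff)
    then show "cut S \<inter> insert e A = {}" using A by blast
  qed blast
  then have "component (insert e A) v = component A v" for v
    unfolding component_def by (intro arg_cong[where f = Inter]) blast
  then show ?thesis using True unfolding components_def by simp
next
  case False
  let ?a = "component A a" and ?b = "component A b"
  have ab: "a \<in> V" "b \<in> V" using ends_subset[OF e(1)] e(2) by auto
  have mem: "?a \<in> components A" "?b \<in> components A" using ab unfolding components_def by auto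
  have "?a \<union> ?b \<notin> components A"
  proof
    assume "?a \<union> ?b \<in> components A"
    then obtain v where v: "v \<in> V" "?a \<union> ?b = component A v" unfolding components_def by blast
    then have "a \<in> component A v" "b \<in> component A v" using in_component by blast+
    then show False using component_eq[OF v(1)] False by simp
  qed
  then have "card (components (insert e A)) = Suc (card (components A - {?a, ?b}))"
    unfolding components_insert[OF e False] using finite_components by simp
  also have "card (components A - {?a, ?b}) = card (components A) - 2"
    using mem False finite_components by (subst card_Diff_subset) auto
  finally have "card (components (insert e A)) = Suc (card (components A) - 2)" .
  moreover have "2 \<le> card (components A)"
    using card_mono[OF finite_components, of "{?a, ?b}" A] mem False by simp
  ultimately show ?thesis using False by simp
qed

text \<open>Diminishing returns: an edge that merges two components of the larger edge set also
  merges two of the smaller one.\<close>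

lemma card_components_Un:
  assumes "A \<subseteq> A'" and "finite C" and "C \<subseteq> E"
  shows "card (components (A \<union> C)) + card (components A') \<le> card (components (A' \<union> C)) + card (components A)"
  using assms(2,3)
proof (induction rule: finite_induct)
  case (insert e C)
  have e: "e \<in> E" using insert.prems by simp
  obtain a b where ab: "ends e = {a, b}" using card_ends[OF e] card_2_iff by metis
  have "a \<in> V" using ends_subset[OF e] ab by simp
  have "component (A' \<union> C) a = component (A' \<union> C) b" if "component (A \<union> C) a = component (A \<union> C) b"
  proof -
    have "b \<in> component (A' \<union> C) a"
      using that in_component[of b "A \<union> C"] component_mono[of "A \<union> C" "A' \<union> C" a] assms(1) by blast
    then show ?thesis using component_eq[OF \<open>a \<in> V\<close>] by simp
  qed
  moreover have IH: "card (components (A \<union> C)) + card (components A')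
      \<le> card (components (A' \<union> C)) + card (components A)" using insert by simp
  ultimately show ?case
    using card_components_insert[OF e ab, of "A \<union> C"] card_components_insert[OF e ab, of "A' \<union> C"]
    by (simp add: of_bool_def split: if_splits)
qed simp

text \<open>This is submodularity of the graphic rank \<open>card V - card (components A)\<close>;
  the number of components itself is supermodular.\<close>

lemma card_components_submodular:
  assumes "A \<subseteq> E"
  shows "card (components A) + card (components B) \<le> card (components (A \<union> B)) + card (components (A \<inter> B))"
proof -
  have "A \<inter> B \<union> A = A" "B \<union> A = A \<union> B" by auto
  then show ?thesis
    using card_components_Un[of "A \<inter> B" B A] finite_subset[OF assms finite_E] assms by simp
qed

text \<open>If deleting \<open>B\<close> leaves at least two components, each has a boundary of
  value at least 2 inside \<open>B\<close>, and every edge is in at most two boundaries; hence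
  \<open>x\<close> has value at least the number of components on \<open>B\<close>. The
  \<open>- 1\<close> is needed for a single component.\<close>

lemma card_components_bound:
  fixes x :: "'e \<Rightarrow> real"
  assumes nn: "\<forall>e\<in>E. 0 \<le> x e" and two: "\<forall>S. S \<subseteq> V \<longrightarrow> S \<noteq> {} \<longrightarrow> S \<noteq> V \<longrightarrow> 2 \<le> sum x (cut S)"
    and B: "B \<subseteq> E"
  shows "real (card (components (E - B))) - 1 \<le> sum x B"
proof (cases "card (components (E - B)) \<le> 1")
  case True
  have "0 \<le> sum x B" using nn B by (intro sum_nonneg) auto
  then show ?thesis using True by linarith
next
  case False
  let ?C = "components (E - B)"
  have fB: "finite B" using finite_subset[OF B finite_E] .
  have cut_B: "cut C \<subseteq> B" if "C \<in> ?C" for C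
    using that cut_component[of "E - B"] cut_subset unfolding components_def by blast
  have two': "2 \<le> sum x (cut C)" if C: "C \<in> ?C" for C
  proof -
    obtain v where v: "v \<in> V" "C = component (E - B) v" using C unfolding components_def by blast
    have "C \<noteq> V"
    proof
      assume CV: "C = V"
      have "D = C" if D: "D \<in> ?C" for D
      proof -
        obtain w where w: "w \<in> V" "D = component (E - B) w" using D unfolding components_def by blast
        then show ?thesis using component_eq[OF v(1), of w] v(2) CV by simp
      qed
      then have "?C \<subseteq> {C}" by blast
      then have "card ?C \<le> card {C}" by (intro card_mono) auto
      then show False using False by simp
    qed
    moreover have "C \<subseteq> V" "C \<noteq> {}" using component_subset[OF v(1)] in_component[of v] v(2) by auto
    ultimately show ?thesis using two by blast
  qed
  have "2 * real (card ?C) = (\<Sum>C\<in>?C. 2)" by simp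
  also have "\<dots> \<le> (\<Sum>C\<in>?C. sum x (cut C))" using two' by (intro sum_mono)
  also have "\<dots> = (\<Sum>C\<in>?C. \<Sum>e\<in>{e\<in>B. e \<in> cut C}. x e)"
    using cut_B by (intro sum.cong) (auto intro!: arg_cong[where f = "sum x"])
  also have "\<dots> = (\<Sum>e\<in>B. \<Sum>C\<in>{C\<in>?C. e \<in> cut C}. x e)" by (rule sum.swap_restrict[OF finite_components fB])
  also have "\<dots> \<le> (\<Sum>e\<in>B. 2 * x e)"
  proof (rule sum_mono)
    fix e assume e: "e \<in> B"
    have "card {C\<in>?C. e \<in> cut C} \<le> 2" using card_cut_parts[OF vertex_partition_components] e B by blast
    then have "real (card {C\<in>?C. e \<in> cut C}) * x e \<le> 2 * x e" using nn e B by (intro mult_right_mono) auto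
    then show "(\<Sum>C\<in>{C\<in>?C. e \<in> cut C}. x e) \<le> 2 * x e" by simp
  qed
  also have "\<dots> = 2 * sum x B" by (simp add: sum_distrib_left)
  finally show ?thesis by simp
qed

text \<open>The link to walks: no edge of \<open>A\<close> leaves the set of vertices reachable from
  \<open>u\<close>, so this set contains the component of \<open>u\<close>.\<close>

lemma components_connected:
  assumes one: "card (components A) \<le> 1" and "u \<in> V" and "v \<in> V" and A: "\<forall>e\<in>A. e \<in> E \<and> 0 < x e"
  shows "(adj_in E ends x)\<^sup>*\<^sup>* u v"
proof -
  define S where "S = {w\<in>V. (adj_in E ends x)\<^sup>*\<^sup>* u w}"
  have "cut S \<inter> A = {}"
  proof (rule ccontr)
    assume "cut S \<inter> A \<noteq> {}"
    then obtain e where "e \<in> A" "e \<in> cut S" by blast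
    then obtain a b where e: "e \<in> A" "e \<in> E" "ends e = {a, b}" "a \<in> S" "b \<notin> S" unfolding cut_iff by blast
    then have "adj_in E ends x a b" using A unfolding adj_in_def by blast
    then have "(adj_in E ends x)\<^sup>*\<^sup>* u b" using e(4) unfolding S_def by (auto intro: rtranclp.rtrancl_into_rtrancl)
    moreover have "b \<in> V" using ends_subset[OF e(2)] e(3) by simp
    ultimately show False using e(5) unfolding S_def by simp
  qed
  then have "component A u \<subseteq> S" using assms(2) unfolding S_def by (intro component_least) auto
  moreover have "component A u = component A v"
  proof (rule ccontr)
    assume "component A u \<noteq> component A v"
    then have "card {component A u, component A v} = 2" by simp
    moreover have "{component A u, component A v} \<subseteq> components A" using assms(2,3) unfolding components_def by blast
    ultimately show False using one card_mono[OF finite_components, of "{component A u, component A v}" A] by simp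
  qed
  ultimately have "v \<in> S" using in_component[of v A] by blast
  then show ?thesis unfolding S_def by simp
qed

section \<open>Stars and odd vertices\<close>

lemma star_iff: "e \<in> cut {v} \<longleftrightarrow> e \<in> E \<and> v \<in> ends e"
  unfolding cut_edges_def by (auto simp: Int_insert_right)

text \<open>The handshake argument for \<open>S\<close>: cut parities add up over the single
  vertices.\<close>

lemma odd_card_cut_vertices:
  assumes J: "J \<subseteq> E" and S: "finite S"
  shows "odd (card (J \<inter> cut S)) \<longleftrightarrow> odd (card (S \<inter> {v. odd (card (J \<inter> cut {v}))}))"
  using S
proof (induction rule: finite_induct)
  case empty
  then show ?case using cut_empty by simp
next
  case (insert v S)
  then have "odd (card (J \<inter> cut (insert v S))) \<longleftrightarrow> (odd (card (J \<inter> cut {v})) \<longleftrightarrow> even (card (J \<inter> cut S)))"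
    using odd_card_cut_Un[OF J, of "{v}" S] by simp
  then show ?case using insert by (auto simp: Int_insert_left)
qed

lemma dominates_joins:
  assumes "\<forall>e\<in>E. 0 \<le> z e \<and> z e \<le> 1"
    and "\<forall>S. S \<subseteq> V \<longrightarrow> odd (card (S \<inter> W)) \<longrightarrow> 1 \<le> sum z (cut S)"
  shows "dominates E incidence {J. J \<subseteq> E \<and> (\<forall>v\<in>V. odd (card (J \<inter> cut {v})) \<longleftrightarrow> v \<in> W)} z"
proof -
  let ?P = "(\<lambda>v. {v}) ` V"
  have "vertex_partition ?P" unfolding vertex_partition_def pairwise_def disjnt_def by auto
  moreover have "join_vector ?P W z"
    unfolding join_vector_def
  proof (intro conjI allI impI)
    fix \<Q> assume Q: "\<Q> \<subseteq> ?P" "odd (card (\<Union>\<Q> \<inter> W))"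
    have "\<Union>\<Q> \<subseteq> V" using Q(1) by auto
    then show "1 \<le> sum z (cut (\<Union>\<Q>))" using assms(2) Q(2) by blast
  qed (rule assms(1))
  ultimately have "dominates E incidence (joins ?P W) z" by (rule dominates_joins_partition)
  moreover have "joins ?P W \<subseteq> {J. J \<subseteq> E \<and> (\<forall>v\<in>V. odd (card (J \<inter> cut {v})) \<longleftrightarrow> v \<in> W)}"
    unfolding joins_def by (auto simp: Int_insert_left split: if_splits)
  ultimately show ?thesis by (rule dominates_mono)
qed

end

subsection \<open>Tours\<close>

lemma greedy_colouring:
  assumes "finite M" and "symp_on M R" and "irreflp_on M R" and "\<forall>e\<in>M. card {f\<in>M. R e f} < k"
  shows "\<exists>c :: 'a \<Rightarrow> nat. (\<forall>e\<in>M. c e < k) \<and> (\<forall>e\<in>M. \<forall>f\<in>M. R e f \<longrightarrow> c e \<noteq> c f)"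
  using assms
proof (induction rule: finite_induct)
  case empty
  then show ?case by simp
next
  case (insert a M)
  have "card {f\<in>M. R e f} < k" if "e \<in> M" for e
  proof -
    have "card {f\<in>M. R e f} \<le> card {f\<in>insert a M. R e f}" using insert(1) by (intro card_mono) auto
    then show ?thesis using insert.prems(3) that by fastforce
  qed
  moreover have "symp_on M R" "irreflp_on M R"
    using symp_on_subset[OF insert.prems(1)] irreflp_on_subset[OF insert.prems(2)] by auto
  ultimately obtain c :: "'a \<Rightarrow> nat" where c: "\<forall>e\<in>M. c e < k" "\<forall>e\<in>M. \<forall>f\<in>M. R e f \<longrightarrow> c e \<noteq> c f"
    using insert.IH by auto
  have "card (c ` {f\<in>M. R a f}) \<le> card {f\<in>M. R a f}" using insert(1) by (intro card_image_le) auto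
  also have "\<dots> \<le> card {f\<in>insert a M. R a f}" using insert(1) by (intro card_mono) auto
  also have "\<dots> < card {..<k}" using insert.prems(3) by simp
  finally have "\<not> {..<k} \<subseteq> c ` {f\<in>M. R a f}"
    using insert(1) card_mono[of "c ` {f\<in>M. R a f}" "{..<k}"] by auto
  then obtain i where i: "i < k" "i \<notin> c ` {f\<in>M. R a f}" by auto
  let ?c = "c(a := i)"
  have sym: "R f a \<longrightarrow> R a f" if "f \<in> M" for f using insert.prems(1) that unfolding symp_on_def by blast
  have "\<not> R a a" using insert.prems(2) unfolding irreflp_on_def by blast
  then have "\<forall>e\<in>insert a M. \<forall>f\<in>insert a M. R e f \<longrightarrow> ?c e \<noteq> ?c f"
    using c(2) i(2) sym insert(2) by (auto simp: image_iff)
  moreover have "\<forall>e\<in>insert a M. ?c e < k" using c(1) i(1) by simp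
  ultimately show ?case by blast
qed

text \<open>Nonemptiness makes the connected graph have exactly one component instead of none; the
  empty graph is settled in the final theorem.\<close>

locale essentially_6_edge_connected = finite_multigraph V E ends
  for V :: "'v set" and E :: "'e set" and ends :: "'e \<Rightarrow> 'v set" +
  assumes connected4: "edge_connected 4 V E ends" and regular4: "regular 4 V E ends"
    and even_V: "even (card V)" and no_proper_cut: "\<not> has_proper_4_edge_cut V E ends"
    and V_nonempty: "V \<noteq> {}"
begin

section \<open>Cut sizes in the given graph\<close>

lemma card_star: "v \<in> V \<Longrightarrow> card (cut {v}) = 4"
proof -
  have "cut {v} = {e\<in>E. v \<in> ends e}" using star_iff by blast
  then show "v \<in> V \<Longrightarrow> card (cut {v}) = 4" using regular4 unfolding regular_def degree_def by simp
qed

lemma card_cut_ge_4: "S \<subseteq> V \<Longrightarrow> S \<noteq> {} \<Longrightarrow> S \<noteq> V \<Longrightarrow> 4 \<le> card (cut S)"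
  using connected4 unfolding edge_connected_def by blast

text \<open>All degrees are even, so all cuts are even; a size of at least 4 other than 4 is then at
  least 6.\<close>

lemma card_cut_ge_6:
  assumes "proper_cut V S"
  shows "6 \<le> card (cut S)"
proof -
  have S: "S \<subseteq> V" "2 \<le> card S" "2 \<le> card (V - S)" using assms unfolding proper_cut_def by auto
  then have "S \<noteq> {}" "S \<noteq> V" by auto
  then have "4 \<le> card (cut S)" using S(1) by (intro card_cut_ge_4)
  moreover have "card (cut S) \<noteq> 4" using no_proper_cut assms unfolding has_proper_4_edge_cut_def by blast
  moreover have "even (card (cut S))"
  proof -
    have E: "E \<inter> cut T = cut T" for T using cut_subset by blast
    have "S \<inter> {v. odd (card (cut {v}))} = {}" using card_star S(1) by auto
    then show ?thesis
      using odd_card_cut_vertices[of E S] finite_subset[OF S(1) finite_V] unfolding E by simp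
  qed
  ultimately show ?thesis by (auto elim!: evenE)
qed

lemma cut_cases:
  assumes S: "S \<subseteq> V" "S \<noteq> {}" "S \<noteq> V"
  obtains v where "v \<in> V" "cut S = cut {v}" | "6 \<le> card (cut S)"
proof -
  have fin: "finite S" "finite (V - S)" using finite_V S(1) finite_subset by auto
  have ne: "card S \<noteq> 0" "card (V - S) \<noteq> 0" using S fin by auto
  consider "card S = 1" | "card (V - S) = 1" | "proper_cut V S"
    using ne S(1) unfolding proper_cut_def by linarith
  then show thesis
  proof cases
    case 1
    then obtain v where "S = {v}" using card_1_singletonE by blast
    then show thesis using that(1)[of v] S(1) by simp
  next
    case 2
    then obtain v where v: "V - S = {v}" using card_1_singletonE by blast
    then have "cut S = cut {v}" using cut_complement[of S] by simp
    then show thesis using that(1)[of v] v by blast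
  next
    case 3
    then show thesis using that(2) card_cut_ge_6 by blast
  qed
qed

section \<open>Perfect matchings\<close>

definition perfect_matchings :: "'e set set" where
  "perfect_matchings = {M. M \<subseteq> E \<and> (\<forall>v\<in>V. card (M \<inter> cut {v}) = 1)}"

text \<open>As \<open>card V\<close> is even, an odd set is neither empty nor all of
  \<open>V\<close>, so its cut has at least four edges of value \<open>1/4\<close>. Stars have value
  exactly 1, hence the joins in use have degree one everywhere.\<close>

lemma dominates_perfect_matchings: "dominates E incidence perfect_matchings (\<lambda>_. 1/4)"
proof -
  let ?X = "{J. J \<subseteq> E \<and> (\<forall>v\<in>V. odd (card (J \<inter> cut {v})) \<longleftrightarrow> v \<in> V)}"
  let ?D = "(\<lambda>v. cut {v}) ` V"
  have "dominates E incidence ?X (\<lambda>_. 1/4)"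
  proof (rule dominates_joins)
    show "\<forall>S. S \<subseteq> V \<longrightarrow> odd (card (S \<inter> V)) \<longrightarrow> 1 \<le> (\<Sum>e\<in>cut S. 1/4 :: real)"
    proof (intro allI impI)
      fix S assume S: "S \<subseteq> V" "odd (card (S \<inter> V))"
      then have "S \<inter> V = S" by blast
      then have "odd (card S)" using S(2) by simp
      then have "S \<noteq> {}" "S \<noteq> V" using even_V by auto
      then have "4 \<le> card (cut S)" using S(1) by (intro card_cut_ge_4)
      then show "1 \<le> (\<Sum>e\<in>cut S. 1/4 :: real)" by simp
    qed
  qed simp
  then have "dominates E incidence {J\<in>?X. \<forall>D\<in>?D. (\<Sum>e\<in>D. incidence J e) = 1} (\<lambda>_. 1/4)"
  proof (rule dominates_restrict_tight)
    show "\<forall>D\<in>?D. finite D \<and> D \<subseteq> E" using finite_cut cut_subset by blast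
    show "\<forall>D\<in>?D. \<forall>J\<in>?X. 1 \<le> (\<Sum>e\<in>D. incidence J e)"
    proof (intro ballI)
      fix D J assume "D \<in> ?D" "J \<in> ?X"
      then obtain v where "v \<in> V" "D = cut {v}" "odd (card (J \<inter> cut {v}))" by auto
      then have "1 \<le> card (J \<inter> D)" using odd_pos by fastforce
      moreover have "(\<Sum>e\<in>D. incidence J e) = card (J \<inter> D)"
        unfolding \<open>D = cut {v}\<close> by (rule sum_incidence[OF finite_cut])
      ultimately show "1 \<le> (\<Sum>e\<in>D. incidence J e)" by linarith
    qed
    show "\<forall>D\<in>?D. (\<Sum>e\<in>D. 1/4 :: real) \<le> 1" using card_star by auto
  qed
  then show ?thesis
  proof (rule dominates_mono, intro subsetI)
    fix J assume J: "J \<in> {J\<in>?X. \<forall>D\<in>?D. (\<Sum>e\<in>D. incidence J e) = 1}"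
    have "card (J \<inter> cut {v}) = 1" if "v \<in> V" for v
    proof -
      have "(\<Sum>e\<in>cut {v}. incidence J e) = 1" using J that by blast
      then have "real (card (J \<inter> cut {v})) = 1" unfolding sum_incidence[OF finite_cut] .
      then show ?thesis by simp
    qed
    then show "J \<in> perfect_matchings" using J unfolding perfect_matchings_def by blast
  qed
qed

lemma perfect_matchingD:
  assumes "M \<in> perfect_matchings"
  shows "M \<subseteq> E" and "v \<in> V \<Longrightarrow> card (M \<inter> cut {v}) = 1"
    and "v \<in> V \<Longrightarrow> card (cut {v} - M) = 3" and "v \<in> V \<Longrightarrow> \<exists>m\<in>M. v \<in> ends m"
    and "e \<in> M \<Longrightarrow> f \<in> M \<Longrightarrow> v \<in> ends e \<Longrightarrow> v \<in> ends f \<Longrightarrow> e = f"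
proof -
  show sub: "M \<subseteq> E" using assms unfolding perfect_matchings_def by blast
  show one: "card (M \<inter> cut {v}) = 1" if "v \<in> V" for v
    using assms that unfolding perfect_matchings_def by blast
  show "card (cut {v} - M) = 3" if "v \<in> V"
  proof -
    have "card (cut {v} - M) = card (cut {v}) - card (M \<inter> cut {v})"
      using finite_cut card_Diff_subset_Int[of "cut {v}" M] by (simp add: Int_commute)
    then show ?thesis using one card_star that by simp
  qed
  show "\<exists>m\<in>M. v \<in> ends m" if v: "v \<in> V"
  proof -
    obtain m where "M \<inter> cut {v} = {m}" using one[OF v] card_1_singletonE by blast
    then show ?thesis using star_iff by blast
  qed
  show "e = f" if ef: "e \<in> M" "f \<in> M" "v \<in> ends e" "v \<in> ends f"
  proof -
    have "v \<in> V" using ef ends_subset sub by blast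
    then obtain m where m: "M \<inter> cut {v} = {m}" using one card_1_singletonE by blast
    have "e \<in> M \<inter> cut {v}" "f \<in> M \<inter> cut {v}" using ef star_iff sub by blast+
    then show ?thesis unfolding m by simp
  qed
qed

section \<open>Conflicts between matching edges\<close>

definition conflict :: "'e set \<Rightarrow> 'e \<Rightarrow> 'e \<Rightarrow> bool" where
  "conflict M e f \<longleftrightarrow> e \<noteq> f \<and> (\<exists>g\<in>E - M. ends g \<inter> ends e \<noteq> {} \<and> ends g \<inter> ends f \<noteq> {})"

text \<open>Each of the two ends of \<open>e\<close> has three edges outside \<open>M\<close>, and
  each of these leads to at most one other matching edge.\<close>

lemma card_conflicts:
  assumes M: "M \<in> perfect_matchings" and e: "e \<in> M"
  shows "card {f\<in>M. conflict M e f} < 7"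
proof -
  have eE: "e \<in> E" using e perfect_matchingD(1)[OF M] by blast
  obtain u v where uv: "ends e = {u, v}" using card_ends[OF eE] card_2_iff by metis
  have V: "u \<in> V" "v \<in> V" using ends_subset[OF eE] uv by auto
  let ?G = "(cut {u} - M) \<union> (cut {v} - M)"
  \<comment> \<open>\<open>h g\<close> is the matching edge at the far end of
    \<open>g\<close>.\<close>
  define h where "h g = (SOME f. f \<in> M \<and> f \<noteq> e \<and> ends g \<inter> ends f \<noteq> {})" for g
  have "{f\<in>M. conflict M e f} \<subseteq> h ` ?G"
  proof
    fix f assume "f \<in> {f\<in>M. conflict M e f}"
    then obtain g where f: "f \<in> M" "e \<noteq> f" and g: "g \<in> E" "g \<notin> M" "ends g \<inter> ends e \<noteq> {}" "ends g \<inter> ends f \<noteq> {}"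
      unfolding conflict_def by blast
    obtain a where a: "a \<in> ends g" "a \<in> ends e" using g(3) by blast
    obtain b where b: "b \<in> ends g" "b \<in> ends f" using g(4) by blast
    have disj: "a \<notin> ends f'" if "f' \<in> M" "f' \<noteq> e" for f'
      using perfect_matchingD(5)[OF M e that(1) a(2)] that(2) by blast
    have "a \<noteq> b" using disj[OF f(1)] f(2) b(2) by blast
    then have "{a, b} = ends g" using a(1) b(1) finite_ends[OF g(1)] card_ends[OF g(1)]
      by (intro card_seteq) auto
    then have gab: "ends g = {a, b}" by simp
    have "h g = f" unfolding h_def
    proof (rule some_equality)
      show "f \<in> M \<and> f \<noteq> e \<and> ends g \<inter> ends f \<noteq> {}" using f g(4) by simp
      fix f' assume f': "f' \<in> M \<and> f' \<noteq> e \<and> ends g \<inter> ends f' \<noteq> {}"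
      then have "b \<in> ends f'" using disj[of f'] unfolding gab by blast
      then show "f' = f" using perfect_matchingD(5)[OF M _ f(1) _ b(2)] f' by simp
    qed
    moreover have "g \<in> ?G" using g(1,2) a uv star_iff[of g u] star_iff[of g v] by auto
    ultimately show "f \<in> h ` ?G" by blast
  qed
  then have "card {f\<in>M. conflict M e f} \<le> card (h ` ?G)" using finite_cut by (intro card_mono) auto
  also have "\<dots> \<le> card ?G" using finite_cut by (intro card_image_le) auto
  also have "\<dots> \<le> card (cut {u} - M) + card (cut {v} - M)" by (rule card_Un_le)
  also have "\<dots> = 6" using perfect_matchingD(3)[OF M] V by simp
  finally show ?thesis by simp
qed

text \<open>Two vertices joined by parallel edges would be separated from the rest by at most four edges.\<close>

lemma parallel_edges:
  assumes "e \<in> E" and "f \<in> E" and "e \<noteq> f" and "ends e = {u, v}" and "ends f = {u, v}"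
  shows "V = {u, v}"
proof (rule ccontr)
  assume ne: "V \<noteq> {u, v}"
  have V: "{u, v} \<subseteq> V" using assms(4) ends_subset[OF assms(1)] by simp
  have uv: "card {u, v} = 2" using assms(4) card_ends[OF assms(1)] by simp
  have "card (V - {u, v}) = card V - 2" using V uv by (subst card_Diff_subset) auto
  moreover have "card {u, v} < card V" using V ne finite_V by (intro psubset_card_mono) auto
  \<comment> \<open>Evenness of \<open>card V\<close> excludes three vertices, so two more remain
    and the cut is proper.\<close>
  ultimately have "2 \<le> card (V - {u, v})" using even_V uv by presburger
  then have "6 \<le> card (cut {u, v})" using V uv by (intro card_cut_ge_6) (auto simp: proper_cut_def)
  \<comment> \<open>Both vertices spend two of their four edges on \<open>e\<close> and
    \<open>f\<close>, so at most \<open>2 + 2\<close> edges leave.\<close>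
  moreover have "cut {u, v} \<subseteq> (cut {u} - {e, f}) \<union> (cut {v} - {e, f})"
  proof -
    have "e \<notin> cut {u, v}" "f \<notin> cut {u, v}" using assms uv unfolding cut_edges_def by auto
    moreover have "{u, v} = {u} \<union> {v}" by auto
    then have "cut {u, v} \<subseteq> cut {u} \<union> cut {v}" using cut_Un_subset[of "{u}" "{v}"] by (simp only:)
    ultimately show ?thesis by blast
  qed
  then have "card (cut {u, v}) \<le> card ((cut {u} - {e, f}) \<union> (cut {v} - {e, f}))"
    using finite_cut by (intro card_mono) auto
  also have "\<dots> \<le> card (cut {u} - {e, f}) + card (cut {v} - {e, f})" by (rule card_Un_le)
  also have "\<dots> = 4"
  proof -
    have "card (cut {w} - {e, f}) = 2" if w: "w = u \<or> w = v" for w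
    proof -
      have "{e, f} \<subseteq> cut {w}" using w assms star_iff[of e w] star_iff[of f w] by auto
      then show ?thesis using card_star[of w] w V assms(3) by (subst card_Diff_subset) auto
    qed
    then show ?thesis by simp
  qed
  finally show False using \<open>6 \<le> card (cut {u, v})\<close> by simp
qed

section \<open>Connected subgraphs containing the matching\<close>

definition conflict_free :: "'e set \<Rightarrow> 'e set \<Rightarrow> bool" where
  "conflict_free M N \<longleftrightarrow> N \<subseteq> M \<and> (\<forall>e\<in>N. \<forall>f\<in>N. \<not> conflict M e f)"

text \<open>Despite the name cycles are allowed: only connectedness matters, together with even
  degree at the ends of \<open>N\<close>.\<close>

definition trees :: "'e set \<Rightarrow> 'e set \<Rightarrow> 'e set set" where
  "trees M N = {T. M \<subseteq> T \<and> T \<subseteq> E \<and> card (components T) \<le> 1 \<and>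
    (\<forall>e\<in>N. \<forall>u\<in>ends e. card (T \<inter> cut {u}) = 2)}"

text \<open>An edge outside \<open>M\<close> that joins ends of two different edges of
  \<open>N\<close> would be a conflict. If it joins the two ends of one edge, it is parallel to it,
  so the graph has two vertices and both stars are the same set, hence a single class.\<close>

lemma disjoint_stars:
  assumes M: "M \<in> perfect_matchings" and N: "conflict_free M N"
  shows "pairwise disjnt ((\<lambda>m. {m}) ` M \<union> (\<lambda>u. cut {u} - M) ` \<Union>(ends ` N))"
proof -
  have star_eq: "cut {u} - M = cut {v} - M"
    if uv: "u \<in> \<Union>(ends ` N)" "v \<in> \<Union>(ends ` N)" and meet: "(cut {u} - M) \<inter> (cut {v} - M) \<noteq> {}" for u v
  proof (cases "u = v")
    case False
    obtain g where "g \<in> cut {u}" "g \<in> cut {v}" "g \<notin> M" using meet by blast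
    then have g: "g \<in> E" "g \<notin> M" "u \<in> ends g" "v \<in> ends g" using star_iff by auto
    obtain e f where ef: "e \<in> N" "u \<in> ends e" "f \<in> N" "v \<in> ends f" using uv by blast
    have "\<not> conflict M e f" using N ef unfolding conflict_free_def by blast
    then have "e = f" using ef g unfolding conflict_def by blast
    have eM: "e \<in> M" using N ef unfolding conflict_free_def by blast
    have eE: "e \<in> E" using eM perfect_matchingD(1)[OF M] by blast
    have "{u, v} = ends e" using ef \<open>e = f\<close> False finite_ends[OF eE] card_ends[OF eE]
      by (intro card_seteq) auto
    moreover have "{u, v} = ends g" using g False finite_ends[OF g(1)] card_ends[OF g(1)]
      by (intro card_seteq) auto
    moreover have "e \<noteq> g" using eM g(2) by blast
    ultimately have "V = {u, v}" by (intro parallel_edges[OF eE g(1)]) simp_all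
    then have "V - {u} = {v}" using False by auto
    then show ?thesis using cut_complement[of "{u}"] by simp
  qed simp
  show ?thesis
    unfolding pairwise_def disjnt_def
  proof (intro ballI impI)
    fix A B assume A: "A \<in> (\<lambda>m. {m}) ` M \<union> (\<lambda>u. cut {u} - M) ` \<Union>(ends ` N)"
      and B: "B \<in> (\<lambda>m. {m}) ` M \<union> (\<lambda>u. cut {u} - M) ` \<Union>(ends ` N)" and ne: "A \<noteq> B"
    consider m where "m \<in> M" "A = {m}" | u where "u \<in> \<Union>(ends ` N)" "A = cut {u} - M" using A by blast
    then show "A \<inter> B = {}"
    proof cases
      case 1
      then show ?thesis using B ne by auto
    next
      case A2: 2
      consider m where "m \<in> M" "B = {m}" | v where "v \<in> \<Union>(ends ` N)" "B = cut {v} - M" using B by blast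
      then show ?thesis
      proof cases
        case 1
        then show ?thesis using A2 by auto
      next
        case 2
        show ?thesis
        proof (rule ccontr)
          assume "A \<inter> B \<noteq> {}"
          then have "A = B" unfolding A2(2) 2(2) by (rule star_eq[OF A2(1) 2(1)])
          then show False using ne by simp
        qed
      qed
    qed
  qed
qed

text \<open>The vector has value \<open>1 + 3/3\<close> on stars and at least \<open>6/3\<close> on
  the other cuts, so every cut has value at least 2. Connectedness becomes a covering condition with
  the supermodular demand \<open>p\<close>, so that \<open>supermodular_dominates\<close>
  applies.\<close>

lemma dominates_trees:
  assumes M: "M \<in> perfect_matchings" and N: "conflict_free M N"
  shows "dominates E incidence (trees M N) (\<lambda>e. 1/3 + 2/3 * incidence M e)"
proof -
  let ?x = "\<lambda>e. 1/3 + 2/3 * incidence M e"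
  \<comment> \<open>The class \<open>{m}\<close> forces \<open>m\<close> into the subgraph; a star
    outside \<open>M\<close> has value \<open>3 * 1/3 = 1\<close> and contributes exactly one more
    edge at that end of \<open>N\<close>.\<close>
  let ?C = "(\<lambda>m. {m}) ` M \<union> (\<lambda>u. cut {u} - M) ` \<Union>(ends ` N)"
  define p where "p B = int (card (components (E - B))) - 1" for B
  have ME: "M \<subseteq> E" using perfect_matchingD(1)[OF M] .
  have NV: "u \<in> V" if "u \<in> \<Union>(ends ` N)" for u
    using that N ME ends_subset unfolding conflict_free_def by blast
  have sx: "sum ?x S = 1/3 * card S + 2/3 * card (M \<inter> S)" if "S \<subseteq> E" for S
    by (rule sum_affine_incidence[OF finite_subset[OF that finite_E]])
  have two: "\<forall>S. S \<subseteq> V \<longrightarrow> S \<noteq> {} \<longrightarrow> S \<noteq> V \<longrightarrow> 2 \<le> sum ?x (cut S)"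
  proof (intro allI impI)
    fix S assume S: "S \<subseteq> V" "S \<noteq> {}" "S \<noteq> V"
    show "2 \<le> sum ?x (cut S)"
      using S
    proof (cases rule: cut_cases)
      case (1 v)
      then show ?thesis unfolding sx[OF cut_subset] using card_star perfect_matchingD(2)[OF M] by simp
    next
      case 2
      have "6 / 3 \<le> real (card (cut S)) / 3" using 2 by simp
      then show ?thesis unfolding sx[OF cut_subset] by simp
    qed
  qed
  have bound: "real_of_int (p B) \<le> sum ?x B" if "B \<subseteq> E" for B
    using card_components_bound[OF _ two that] unfolding p_def by simp
  have "p {} = 0"
  proof -
    have "components E \<noteq> {}" unfolding components_def using V_nonempty by simp
    then have "card (components E) \<ge> 1" using finite_components by (simp add: Suc_leI card_gt_0_iff)
    moreover have "real_of_int (p {}) \<le> 0" using bound[of "{}"] by simp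
    ultimately show ?thesis unfolding p_def by simp
  qed
  moreover have "p A + p B \<le> p (A \<union> B) + p (A \<inter> B)" for A B
  proof -
    have "(E - A) \<union> (E - B) = E - A \<inter> B" "(E - A) \<inter> (E - B) = E - (A \<union> B)" by auto
    then show ?thesis using card_components_submodular[of "E - A" "E - B"] unfolding p_def by simp
  qed
  moreover have "\<forall>C\<in>?C. C \<subseteq> E" using ME cut_subset by auto
  moreover have "\<forall>C\<in>?C. sum ?x C = 1"
  proof
    fix C assume "C \<in> ?C"
    then consider m where "m \<in> M" "C = {m}" | u where "u \<in> \<Union>(ends ` N)" "C = cut {u} - M" by blast
    then show "sum ?x C = 1"
    proof cases
      case 1
      then show ?thesis by simp
    next
      case 2
      then have "u \<in> V" using NV by blast
      have "sum ?x C = (\<Sum>e\<in>C. 1/3)" unfolding 2(2) by (intro sum.cong) auto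
      then show ?thesis unfolding 2(2) using perfect_matchingD(3)[OF M \<open>u \<in> V\<close>] by simp
    qed
  qed
  ultimately have "dominates E incidence
    {J. J \<subseteq> E \<and> (\<forall>B. B \<subseteq> E \<longrightarrow> p B \<le> card (J \<inter> B)) \<and> (\<forall>C\<in>?C. card (J \<inter> C) = 1)} ?x"
    using bound disjoint_stars[OF M N] finite_E by (intro supermodular_dominates) auto
  then show ?thesis
  proof (rule dominates_mono, intro subsetI)
    fix T assume "T \<in> {J. J \<subseteq> E \<and> (\<forall>B. B \<subseteq> E \<longrightarrow> p B \<le> card (J \<inter> B)) \<and> (\<forall>C\<in>?C. card (J \<inter> C) = 1)}"
    then have T: "T \<subseteq> E" "\<forall>B. B \<subseteq> E \<longrightarrow> p B \<le> card (T \<inter> B)" "\<forall>C\<in>?C. card (T \<inter> C) = 1" by auto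
    have MT: "M \<subseteq> T"
    proof
      fix m assume "m \<in> M"
      then have "card (T \<inter> {m}) = 1" using T(3) by blast
      then show "m \<in> T" by (cases "m \<in> T") auto
    qed
    \<comment> \<open>The demand of the complement of \<open>T\<close> must be met by no edge at
      all, which says that \<open>T\<close> is connected.\<close>
    have "p (E - T) \<le> card (T \<inter> (E - T))" using T(2) by blast
    moreover have "T \<inter> (E - T) = {}" "E - (E - T) = T" using T(1) by auto
    ultimately have "card (components T) \<le> 1" unfolding p_def by simp
    moreover have "card (T \<inter> cut {u}) = 2" if u: "e \<in> N" "u \<in> ends e" for e u
    proof -
      have uN: "u \<in> \<Union>(ends ` N)" using u by blast
      then have "card (T \<inter> (cut {u} - M)) = 1" using T(3) by blast
      moreover have "card (M \<inter> cut {u}) = 1" using perfect_matchingD(2)[OF M NV[OF uN]] .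
      moreover have "T \<inter> cut {u} = T \<inter> (cut {u} - M) \<union> (M \<inter> cut {u})" using MT by blast
      moreover have "card (T \<inter> (cut {u} - M) \<union> (M \<inter> cut {u})) = card (T \<inter> (cut {u} - M)) + card (M \<inter> cut {u})"
        using finite_cut by (intro card_Un_disjoint) auto
      ultimately show ?thesis by simp
    qed
    ultimately show "T \<in> trees M N" using T(1) MT unfolding trees_def by blast
  qed
qed

section \<open>Parity correction and averaging\<close>

definition tours :: "('e \<Rightarrow> nat) set" where
  "tours = {x. is_tour V E ends x}"

abbreviation multiplicity :: "('e \<Rightarrow> nat) \<Rightarrow> 'e \<Rightarrow> real" where
  "multiplicity x e \<equiv> real (x e)"

lemma tree_plus_join_tour:
  assumes T: "T \<subseteq> E" "card (components T) \<le> 1" and J: "J \<subseteq> E"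
    and par: "\<forall>v\<in>V. odd (card (J \<inter> cut {v})) \<longleftrightarrow> odd (card (T \<inter> cut {v}))"
  shows "(\<lambda>e. of_bool (e \<in> T) + of_bool (e \<in> J)) \<in> tours" (is "?x \<in> _")
proof -
  have "(adj_in E ends ?x)\<^sup>*\<^sup>* u v" if "u \<in> V" "v \<in> V" for u v
    by (rule components_connected[OF T(2) that]) (use T(1) in auto)
  moreover have "even (\<Sum>e\<in>{e\<in>E. v \<in> ends e}. ?x e)" if v: "v \<in> V" for v
  proof -
    have "{e\<in>E. v \<in> ends e} = cut {v}" using star_iff by blast
    moreover have "(\<Sum>e\<in>cut {v}. ?x e) = card (T \<inter> cut {v}) + card (J \<inter> cut {v})"
      using finite_cut by (simp add: sum.distrib Int_commute)
    ultimately show ?thesis using par v by simp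
  qed
  moreover have "?x e = 0" if "e \<notin> E" for e using that T(1) J by auto
  ultimately show ?thesis unfolding tours_def is_tour_def by blast
qed

text \<open>Cuts with six edges already have \<open>6 * 1/6 = 1\<close>. A star has
  \<open>4/6 + 1/3 = 1\<close> when its matching edge is outside \<open>N\<close>; the other stars
  impose no condition, since their vertex has degree two in \<open>T\<close>.\<close>

lemma dominates_tree_join:
  assumes M: "M \<in> perfect_matchings" and N: "N \<subseteq> M" and T: "T \<in> trees M N"
  shows "dominates E multiplicity tours (\<lambda>e. 1/6 + 1/3 * incidence (M - N) e + incidence T e)"
proof -
  let ?z = "\<lambda>e. 1/6 + 1/3 * incidence (M - N) e"
  let ?W = "{v. odd (card (T \<inter> cut {v}))}"
  have T': "M \<subseteq> T" "T \<subseteq> E" "card (components T) \<le> 1" "\<forall>e\<in>N. \<forall>u\<in>ends e. card (T \<inter> cut {u}) = 2"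
    using T unfolding trees_def by auto
  have sz: "sum ?z S = 1/6 * card S + 1/3 * card ((M - N) \<inter> S)" if "S \<subseteq> E" for S
    by (rule sum_affine_incidence[OF finite_subset[OF that finite_E]])
  have "dominates E incidence {J. J \<subseteq> E \<and> (\<forall>v\<in>V. odd (card (J \<inter> cut {v})) \<longleftrightarrow> v \<in> ?W)} ?z"
  proof (rule dominates_joins)
    show "\<forall>e\<in>E. 0 \<le> ?z e \<and> ?z e \<le> 1" by simp
    show "\<forall>S. S \<subseteq> V \<longrightarrow> odd (card (S \<inter> ?W)) \<longrightarrow> 1 \<le> sum ?z (cut S)"
    proof (intro allI impI)
      fix S assume S: "S \<subseteq> V" and odd: "odd (card (S \<inter> ?W))"
      \<comment> \<open>Stating oddness through the cut treats \<open>S = {v}\<close> and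
        \<open>S = V - {v}\<close> alike.\<close>
      have oddS: "odd (card (T \<inter> cut S))"
        using odd odd_card_cut_vertices[OF T'(2) finite_subset[OF S finite_V]] by blast
      then have "S \<noteq> {}" "S \<noteq> V" using cut_empty cut_V by auto
      with S show "1 \<le> sum ?z (cut S)"
      proof (cases rule: cut_cases)
        case (1 v)
        obtain m where m: "m \<in> M" "v \<in> ends m" using perfect_matchingD(4)[OF M 1(1)] by blast
        have "m \<notin> N" using T'(4) m(2) oddS unfolding 1(2) by auto
        moreover have "m \<in> cut {v}" using m perfect_matchingD(1)[OF M] star_iff by blast
        ultimately have "(M - N) \<inter> cut {v} \<noteq> {}" using m(1) by blast
        then have "1 \<le> card ((M - N) \<inter> cut {v})" using finite_cut by (simp add: Suc_leI card_gt_0_iff)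
        then have "1 \<le> real (card ((M - N) \<inter> cut {v}))" by simp
        then show ?thesis unfolding 1(2) sz[OF cut_subset] card_star[OF 1(1)] by simp
      next
        case 2
        have "6 / 6 \<le> real (card (cut S)) / 6" using 2 by simp
        then show ?thesis unfolding sz[OF cut_subset] by simp
      qed
    qed
  qed
  then show ?thesis
  proof (rule dominates_trans[where a = "incidence T" and c = "\<lambda>_. 1"])
    show "\<forall>J\<in>{J. J \<subseteq> E \<and> (\<forall>v\<in>V. odd (card (J \<inter> cut {v})) \<longleftrightarrow> v \<in> ?W)}.
      dominates E multiplicity tours (\<lambda>e. incidence T e + 1 * incidence J e)"
    proof
      fix J assume "J \<in> {J. J \<subseteq> E \<and> (\<forall>v\<in>V. odd (card (J \<inter> cut {v})) \<longleftrightarrow> v \<in> ?W)}"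
      then have J: "J \<subseteq> E" "\<forall>v\<in>V. odd (card (J \<inter> cut {v})) \<longleftrightarrow> odd (card (T \<inter> cut {v}))" by auto
      show "dominates E multiplicity tours (\<lambda>e. incidence T e + 1 * incidence J e)"
        by (rule dominates.base[OF tree_plus_join_tour[OF T'(2,3) J]]) simp
    qed
  qed simp_all
qed

text \<open>Subgraph and join add up: \<open>1/6 + 1/3 = 1/2\<close>, and since \<open>N\<close> is
  part of \<open>M\<close>, the remaining terms give \<open>M\<close> minus a third of
  \<open>N\<close>.\<close>

lemma dominates_tours_conflict_free:
  assumes M: "M \<in> perfect_matchings" and N: "conflict_free M N"
  shows "dominates E multiplicity tours (\<lambda>e. 1/2 + incidence M e - 1/3 * incidence N e)"
proof (rule dominates_trans[OF dominates_trees[OF M N],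
    where a = "\<lambda>e. 1/6 + 1/3 * incidence (M - N) e" and c = "\<lambda>_. 1"])
  have NM: "N \<subseteq> M" using N unfolding conflict_free_def by blast
  show "\<forall>T\<in>trees M N. dominates E multiplicity tours (\<lambda>e. 1/6 + 1/3 * incidence (M - N) e + 1 * incidence T e)"
    using dominates_tree_join[OF M NM] by simp
  show "\<forall>e\<in>E. 1/6 + 1/3 * incidence (M - N) e + 1 * (1/3 + 2/3 * incidence M e)
      \<le> 1/2 + incidence M e - 1/3 * incidence N e"
    using NM by auto
qed simp

text \<open>Each matching edge has exactly one of the seven colours, so it saves \<open>1/3\<close>
  in one case out of seven: \<open>1 - 1/21 = 20/21\<close>.\<close>

lemma dominates_tours_matching:
  assumes M: "M \<in> perfect_matchings"
  shows "dominates E multiplicity tours (\<lambda>e. 1/2 + 20/21 * incidence M e)"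
proof -
  have "finite M" using finite_subset[OF perfect_matchingD(1)[OF M] finite_E] .
  moreover have "symp_on M (conflict M)" "irreflp_on M (conflict M)"
    unfolding symp_on_def irreflp_on_def conflict_def by blast+
  ultimately obtain c :: "'e \<Rightarrow> nat" where c: "\<forall>e\<in>M. c e < 7"
    "\<forall>e\<in>M. \<forall>f\<in>M. conflict M e f \<longrightarrow> c e \<noteq> c f"
    using greedy_colouring[of M "conflict M" 7] card_conflicts[OF M] by auto
  define N where "N i = {e\<in>M. c e = i}" for i
  have "conflict_free M (N i)" for i
  proof -
    have "\<not> conflict M e f" if "e \<in> N i" "f \<in> N i" for e f
    proof
      assume "conflict M e f"
      moreover have "e \<in> M" "f \<in> M" "c e = c f" using that unfolding N_def by auto
      ultimately show False using c(2) by blast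
    qed
    then show ?thesis unfolding conflict_free_def N_def by blast
  qed
  then have "dominates E multiplicity tours
    (\<lambda>e. (\<Sum>i<7. 1 * (1/2 + incidence M e - 1/3 * incidence (N i) e)) / (\<Sum>i<7::nat. 1))"
    using dominates_tours_conflict_free[OF M] by (intro dominates_sum) auto
  then show ?thesis
  proof (rule dominates_weaken, intro ballI)
    fix e
    have "(\<Sum>i<7. incidence (N i) e) = incidence M e"
    proof -
      have "(\<Sum>i<7. incidence (N i) e) = (\<Sum>i<7. if i = c e then incidence M e else 0)"
        unfolding N_def by (intro sum.cong) auto
      also have "\<dots> = incidence M e" using c(1) by (subst sum.delta) auto
      finally show ?thesis .
    qed
    then show "(\<Sum>i<7. 1 * (1/2 + incidence M e - 1/3 * incidence (N i) e)) / (\<Sum>i<7::nat. 1)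
        \<le> 1/2 + 20/21 * incidence M e"
      by (simp add: sum.distrib sum_subtractf sum_divide_distrib[symmetric] del: sum_of_bool_eq)
  qed
qed

lemma dominates_tours: "dominates E multiplicity tours (\<lambda>_. 31/42)"
  by (rule dominates_trans[OF dominates_perfect_matchings, where a = "\<lambda>_. 1/2" and c = "\<lambda>_. 20/21"])
    (use dominates_tours_matching in auto)

end

theorem mainTheorem4:
  fixes V :: "'v set" and E :: "'e set" and ends :: "'e \<Rightarrow> 'v set"
  assumes "multigraph V E ends"
    and "edge_connected 4 V E ends"
    and "regular 4 V E ends"
    and "even (card V)"
    and "\<not> has_proper_4_edge_cut V E ends"
  shows "dominates_convex_tours V E ends (\<lambda>e. (3/2 - 1/42) * (1/2 :: real))"
proof -
  let ?X = "{x. is_tour V E ends x}"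
  have "dominates E (\<lambda>x e. real (x e)) ?X (\<lambda>_. 31/42)"
  proof (cases "V = {}")
    case True
    \<comment> \<open>Without vertices there are no edges, and the zero vector is vacuously a
      tour.\<close>
    then have "E = {}" using assms(1) unfolding multigraph_def by fastforce
    have "(\<lambda>_. 0) \<in> ?X" unfolding is_tour_def using True by simp
    then show ?thesis by (rule dominates.base) (simp add: \<open>E = {}\<close>)
  next
    case False
    then interpret essentially_6_edge_connected V E ends
      using assms by unfold_locales
    show ?thesis using dominates_tours unfolding tours_def .
  qed
  from dominates_combination[OF this] show ?thesis
    unfolding dominates_convex_tours_def by (elim exE conjE) (intro exI conjI; auto)
qed

end
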